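(* Let $p:\mathbb{C}^n\to\mathbb{R}$ be a nonnegative weighted homogeneous balanced polynomial with respect to a tuple $m=(m_1,\dots,m_n)$ of positive integers, and let $\mathcal{E}_p=\{(z,w)\in\mathbb{C}\times\mathbb{C}^n:|z|^2+p(w)<1\}$ and $\mathbb{B}_p=\{w\in\mathbb{C}^n:p(w)<1\}$. For $k\in\mathbb{N}$, let $Y_p(k;\cdot,\cdot)$ be the reproducing kernel of the weighted Bergman space $\mathcal{W}_p(k)=A^2(\mathbb{B}_p,(1-p)^{k+1})$. Then for $z,Z\in\mathbb{C}$ and $w,W\in\mathbb{C}^n$ such that $(z,w),(Z,W)\in\mathcal{E}_p$, the Bergman kernel $B$ of $\mathcal{E}_p$ is given by $$B(z,w;Z,W)=\sum_{k=0}^\infty\frac{k+1}{\pi}\,Y_p(k;w,W)\,z^k\,\overline{Z}^k.$$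
   Context: $\mathbb{N}=\{0,1,2,\dots\}$; $dV$ denotes Lebesgue measure; $\mathcal{O}(\Omega)$ is the space of holomorphic functions on $\Omega$. For $\alpha\in\mathbb{N}^n$ the weight with respect to $m$ is $\mathrm{wt}_m(\alpha)=\sum_{i=1}^n\frac{\alpha_i}{2m_i}$. A real-valued polynomial $p:\mathbb{C}^n\to\mathbb{R}$ is weighted homogeneous balanced with respect to $m$ if it has the form $p(w)=\sum_{\mathrm{wt}_m(\alpha)=\mathrm{wt}_m(\beta)=1/2}C_{\alpha,\beta}w^\alpha\overline{w}^\beta$. For a domain $\Omega$ and a continuous function $\lambda>0$ on $\Omega$, $A^2(\Omega,\lambda)=\{f\in\mathcal{O}(\Omega):\int_\Omega|f|^2\lambda\,dV<\infty\}$ is the weighted Bergman space, and $A^2(\Omega)=A^2(\Omega,1)$. Its reproducing kernel is the function $K:\Omega\times\Omega\to\mathbb{C}$ such that, for each $z\in\Omega$, $\overline{K(z,\cdot)}\in A^2(\Omega,\lambda)$ and $f(z)=\int_\Omega f(\zeta)K(z,\zeta)\lambda(\zeta)\,dV(\zeta)$ for all $f\in A^2(\Omega,\lambda)$. The Bergman kernel of $\Omega$ is the reproducing kernel of $A^2(\Omega)$. The case $n=0$ is allowed: then $\mathbb{C}^0=\mathbb{B}_p$ is a single point of unit mass, $p\equiv0$, and $\mathcal{W}_p(k)=\mathbb{C}$ for all $k$. *)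

theory Defs
  imports "HOL-Analysis.Analysis"
begin

text \<open>
  Type-indexed spaces such as \<^typ>\<open>complex ^ 'n\<close> exclude dimension 0. Therefore
  \<open>\<complex>\<^sup>I\<close>, for a finite index set \<open>I\<close> of natural numbers, is the set of functions that
  are \<open>undefined\<close> outside \<open>I\<close>. Points of \<open>\<complex>\<^sup>n\<close> have the indices \<open>{1..n}\<close>, and
  points \<open>(z, w)\<close> of \<open>\<complex> \<times> \<complex>\<^sup>n\<close> have the indices \<open>{0..n}\<close>, with \<open>z\<close> at index \<open>0\<close>.
\<close>

type_synonym point = "nat \<Rightarrow> complex"

definition cspace :: "nat set \<Rightarrow> point set" where
  "cspace I = (\<Pi>\<^sub>E i\<in>I. UNIV)"

definition cpair :: "complex \<Rightarrow> point \<Rightarrow> point" where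
  "cpair z w = w(0 := z)"

text \<open>Lebesgue measure on \<open>\<complex>\<^sup>I\<close>; for \<open>I = {}\<close> it is the unit mass at the only point.\<close>

definition leb :: "nat set \<Rightarrow> point measure" where
  "leb I = (\<Pi>\<^sub>M i\<in>I. lborel)"

text \<open>
  Continuity refers to the product topology on functions, which on \<open>cspace I\<close> is the
  Euclidean one. Meant for open \<open>\<Omega> \<subseteq> \<complex>\<^sup>I\<close>.
\<close>

definition holomorphic_several :: "nat set \<Rightarrow> (point \<Rightarrow> complex) \<Rightarrow> point set \<Rightarrow> bool" where
  "holomorphic_several I f \<Omega> \<longleftrightarrow>
     continuous_on \<Omega> f \<and>
     (\<forall>v\<in>\<Omega>. \<forall>i\<in>I. (\<lambda>t. f (v(i := t))) field_differentiable (at (v i)))"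

text \<open>Elements of \<open>A2 I \<Omega> \<rho>\<close> are total functions, of which only the values on \<open>\<Omega>\<close> matter.\<close>

definition A2 :: "nat set \<Rightarrow> point set \<Rightarrow> (point \<Rightarrow> real) \<Rightarrow> (point \<Rightarrow> complex) set" where
  "A2 I \<Omega> \<rho> = {f. holomorphic_several I f \<Omega> \<and>
     set_integrable (leb I) \<Omega> (\<lambda>\<zeta>. (cmod (f \<zeta>))\<^sup>2 * \<rho> \<zeta>)}"

definition is_reproducing_kernel ::
    "nat set \<Rightarrow> point set \<Rightarrow> (point \<Rightarrow> real) \<Rightarrow> (point \<Rightarrow> point \<Rightarrow> complex) \<Rightarrow> bool" where
  "is_reproducing_kernel I \<Omega> \<rho> K \<longleftrightarrow>
     (\<forall>z\<in>\<Omega>. (\<lambda>\<zeta>. cnj (K z \<zeta>)) \<in> A2 I \<Omega> \<rho> \<and>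
       (\<forall>f\<in>A2 I \<Omega> \<rho>. f z = (LINT \<zeta>:\<Omega>|leb I. f \<zeta> * K z \<zeta> * complex_of_real (\<rho> \<zeta>))))"

definition is_Bergman_kernel ::
    "nat set \<Rightarrow> point set \<Rightarrow> (point \<Rightarrow> point \<Rightarrow> complex) \<Rightarrow> bool" where
  "is_Bergman_kernel I \<Omega> K \<longleftrightarrow> is_reproducing_kernel I \<Omega> (\<lambda>_. 1) K"

definition wt :: "nat \<Rightarrow> (nat \<Rightarrow> nat) \<Rightarrow> (nat \<Rightarrow> nat) \<Rightarrow> real" where
  "wt n m \<alpha> = (\<Sum>i=1..n. real (\<alpha> i) / (2 * real (m i)))"

text \<open>Finite whenever the \<open>m\<^sub>i\<close> are positive, since then \<open>\<alpha>\<^sub>i \<le> m\<^sub>i\<close>.\<close>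

definition half_weight_indices :: "nat \<Rightarrow> (nat \<Rightarrow> nat) \<Rightarrow> (nat \<Rightarrow> nat) set" where
  "half_weight_indices n m = {\<alpha> \<in> (\<Pi>\<^sub>E i\<in>{1..n}. UNIV). wt n m \<alpha> = 1/2}"

definition weighted_homogeneous_balanced ::
    "nat \<Rightarrow> (nat \<Rightarrow> nat) \<Rightarrow> (point \<Rightarrow> real) \<Rightarrow> bool" where
  "weighted_homogeneous_balanced n m p \<longleftrightarrow>
     (\<exists>C :: (nat \<Rightarrow> nat) \<Rightarrow> (nat \<Rightarrow> nat) \<Rightarrow> complex. \<forall>w\<in>cspace {1..n}.
        complex_of_real (p w) =
          (\<Sum>\<alpha>\<in>half_weight_indices n m. \<Sum>\<beta>\<in>half_weight_indices n m.
             C \<alpha> \<beta> * (\<Prod>i=1..n. w i ^ \<alpha> i) * (\<Prod>i=1..n. cnj (w i) ^ \<beta> i)))"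

definition ellipsoid_dom :: "nat \<Rightarrow> (point \<Rightarrow> real) \<Rightarrow> point set" where
  "ellipsoid_dom n p = {cpair z w | z w. w \<in> cspace {1..n} \<and> (cmod z)\<^sup>2 + p w < 1}"

definition ball_dom :: "nat \<Rightarrow> (point \<Rightarrow> real) \<Rightarrow> point set" where
  "ball_dom n p = {w \<in> cspace {1..n}. p w < 1}"

end

theory Submission
  imports Defs "HOL-Complex_Analysis.Complex_Analysis"
begin

text \<open>
  Fix \<open>(z, w)\<close> in the ellipsoid and let \<open>b\<close> be the complex conjugate of \<open>B(z, w; \<cdot>)\<close>, the element of
  the Bergman space that represents evaluation at \<open>(z, w)\<close>. The fibre of the ellipsoid over a point
  \<open>W\<close> of the ball is the disc of squared radius \<open>1 - p(W)\<close>, and on it \<open>b\<close> has a Taylor expansion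
  \<open>b(Z, W) = \<Sum>\<^sub>k a\<^sub>k(W) Z\<^sup>k\<close>. The theorem follows by identifying the coefficients \<open>a\<^sub>k\<close>.

  On the disc of radius \<open>R\<close> the monomials are orthogonal, and the squared norm of \<open>Z\<^sup>k\<close> is
  \<open>\<pi> R\<^sup>2\<^sup>k\<^sup>+\<^sup>2 / (k + 1)\<close>, which over \<open>W\<close> is \<open>\<pi> (1 - p(W))\<^sup>k\<^sup>+\<^sup>1 / (k + 1)\<close>. This has two consequences.
  Bessel's inequality on the fibres shows that \<open>a\<^sub>k\<close> lies in the space with weight \<open>(1 - p)\<^sup>k\<^sup>+\<^sup>1\<close>
  (\<open>fibre_coeff_A2\<close>). For every \<open>f\<close> in that space, \<open>f(W) Z\<^sup>k\<close> lies in the Bergman space of the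
  ellipsoid (\<open>fibre_monomial_A2\<close>), and its inner product with \<open>b\<close> is \<open>\<pi> / (k + 1)\<close> times the
  weighted inner product of \<open>f\<close> with \<open>a\<^sub>k\<close> (\<open>inner_fibre_monomial\<close>). By the choice of \<open>b\<close>
  the former is \<open>f(w) z\<^sup>k\<close>. So \<open>a\<^sub>k\<close> and the conjugate of \<open>(k + 1) / \<pi> Y(k; w, \<cdot>) z\<^sup>k\<close> represent the
  same functional, and representers are unique (\<open>A2_representer_unique\<close>). Inserting this into the
  Taylor expansion, which converges pointwise because \<open>b\<close> is holomorphic on each fibre, and
  conjugating gives the formula.

  Orthogonality on discs is obtained from rotation invariance of area together with Cauchy's formula
  (\<open>disc_integral_eq_taylor_coeff\<close>), and holomorphy of \<open>a\<^sub>k\<close> from Morera's theorem applied to means over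
  circles (\<open>fibre_coeff_holomorphic\<close>).
\<close>

section \<open>Rotations and radial integrals in the plane\<close>

lemma lborel_complex_eq_distr:
  "(lborel :: complex measure) = distr (lborel \<Otimes>\<^sub>M lborel) borel (\<lambda>(x, y). Complex x y)"
proof (rule lborel_eqI)
  fix l u :: complex
  assume lu: "\<And>b. b \<in> Basis \<Longrightarrow> l \<bullet> b \<le> u \<bullet> b"
  have "(\<lambda>(x, y). Complex x y) -` box l u \<inter> space (lborel \<Otimes>\<^sub>M lborel)
      = {Re l<..<Re u} \<times> {Im l<..<Im u}"
    by (auto simp: in_box_complex_iff space_pair_measure)
  moreover have "(\<lambda>(x, y). Complex x y) \<in> borel_measurable (lborel \<Otimes>\<^sub>M lborel)"
    unfolding Complex_eq by measurable
  moreover have "Re l \<le> Re u" "Im l \<le> Im u"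
    using lu[of 1] lu[of \<i>] by (auto simp: Basis_complex_def)
  ultimately show "emeasure (distr (lborel \<Otimes>\<^sub>M lborel) borel (\<lambda>(x, y). Complex x y)) (box l u)
      = ennreal (\<Prod>b\<in>Basis. (u - l) \<bullet> b)"
    by (simp add: emeasure_distr lborel.emeasure_pair_measure_Times Basis_complex_def
        ennreal_mult)
qed simp

lemma nn_integral_lborel_complex:
  fixes g :: "complex \<Rightarrow> ennreal"
  assumes [measurable]: "g \<in> borel_measurable borel"
  shows "(\<integral>\<^sup>+z. g z \<partial>lborel) = (\<integral>\<^sup>+y. (\<integral>\<^sup>+x. g (Complex x y) \<partial>lborel) \<partial>lborel)"
    and "(\<integral>\<^sup>+z. g z \<partial>lborel) = (\<integral>\<^sup>+x. (\<integral>\<^sup>+y. g (Complex x y) \<partial>lborel) \<partial>lborel)"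
proof -
  have [measurable]: "(\<lambda>(x, y). Complex x y) \<in> borel_measurable (lborel \<Otimes>\<^sub>M lborel)"
    unfolding Complex_eq by measurable
  have m: "(\<lambda>(x, y). g (Complex x y)) \<in> borel_measurable (lborel \<Otimes>\<^sub>M lborel)"
    using measurable_compose[OF \<open>(\<lambda>(x, y). Complex x y) \<in> _\<close> assms]
    by (simp add: case_prod_unfold)
  have *: "(\<integral>\<^sup>+z. g z \<partial>lborel) = (\<integral>\<^sup>+z. (\<lambda>(x, y). g (Complex x y)) z \<partial>(lborel \<Otimes>\<^sub>M lborel))"
    by (subst lborel_complex_eq_distr, subst nn_integral_distr)
       (auto simp: case_prod_unfold)
  show "(\<integral>\<^sup>+z. g z \<partial>lborel) = (\<integral>\<^sup>+x. (\<integral>\<^sup>+y. g (Complex x y) \<partial>lborel) \<partial>lborel)"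
    unfolding * by (subst lborel.nn_integral_fst[OF m, symmetric]) simp
  show "(\<integral>\<^sup>+z. g z \<partial>lborel) = (\<integral>\<^sup>+y. (\<integral>\<^sup>+x. g (Complex x y) \<partial>lborel) \<partial>lborel)"
    unfolding * by (subst lborel_pair.nn_integral_snd[OF m, symmetric]) simp
qed

lemma nn_integral_real_translate:
  fixes g :: "real \<Rightarrow> ennreal"
  assumes [measurable]: "g \<in> borel_measurable borel"
  shows "(\<integral>\<^sup>+x. g (x + c) \<partial>lborel) = (\<integral>\<^sup>+x. g x \<partial>lborel)"
  using nn_integral_real_affine[of g 1 c] by (simp add: add.commute)

text \<open>
  A shear translates each line parallel to one axis, so by Tonelli it preserves Lebesgue measure.
  Shears are useful because every rotation except the half turn is a product of three of them.
\<close>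

lemma nn_integral_shear_Re:
  fixes g :: "complex \<Rightarrow> ennreal" and a :: real
  assumes [measurable]: "g \<in> borel_measurable borel"
  shows "(\<integral>\<^sup>+z. g (z + of_real (a * Im z)) \<partial>lborel) = (\<integral>\<^sup>+z. g z \<partial>lborel)"
proof -
  have *: "(\<integral>\<^sup>+z. g (z + of_real (a * Im z)) \<partial>lborel)
      = (\<integral>\<^sup>+y. (\<integral>\<^sup>+x. g (Complex x y + of_real (a * y)) \<partial>lborel) \<partial>lborel)"
    by (subst nn_integral_lborel_complex(1)) simp_all
  have "(\<integral>\<^sup>+x. g (Complex x y + of_real (a * y)) \<partial>lborel) = (\<integral>\<^sup>+x. g (Complex x y) \<partial>lborel)" for y
  proof -
    have "(\<lambda>x. g (Complex x y)) \<in> borel_measurable borel" unfolding Complex_eq by measurable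
    from nn_integral_real_translate[OF this, of "a * y"] show ?thesis
      by (simp add: Complex_eq algebra_simps)
  qed
  then show ?thesis unfolding * by (subst nn_integral_lborel_complex(1)) simp_all
qed

lemma nn_integral_shear_Im:
  fixes g :: "complex \<Rightarrow> ennreal" and a :: real
  assumes [measurable]: "g \<in> borel_measurable borel"
  shows "(\<integral>\<^sup>+z. g (z + \<i> * of_real (a * Re z)) \<partial>lborel) = (\<integral>\<^sup>+z. g z \<partial>lborel)"
proof -
  have *: "(\<integral>\<^sup>+z. g (z + \<i> * of_real (a * Re z)) \<partial>lborel)
      = (\<integral>\<^sup>+x. (\<integral>\<^sup>+y. g (Complex x y + \<i> * of_real (a * x)) \<partial>lborel) \<partial>lborel)"
    by (subst nn_integral_lborel_complex(2)) simp_all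
  have "(\<integral>\<^sup>+y. g (Complex x y + \<i> * of_real (a * x)) \<partial>lborel) = (\<integral>\<^sup>+y. g (Complex x y) \<partial>lborel)" for x
  proof -
    have "(\<lambda>y. g (Complex x y)) \<in> borel_measurable borel" unfolding Complex_eq by measurable
    from nn_integral_real_translate[OF this, of "a * x"] show ?thesis
      by (simp add: Complex_eq algebra_simps)
  qed
  then show ?thesis unfolding * by (subst nn_integral_lborel_complex(2)) simp_all
qed

text \<open>
  For \<open>c = cos \<theta> + \<i> sin \<theta>\<close> the three shears have the parameters \<open>-tan (\<theta>/2)\<close>, \<open>sin \<theta>\<close> and
  \<open>-tan (\<theta>/2)\<close>; the half turn is excluded because its half angle has no tangent.
\<close>

lemma nn_integral_rotate_aux:
  fixes g :: "complex \<Rightarrow> ennreal"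
  assumes g [measurable]: "g \<in> borel_measurable borel" and c: "norm c = 1" "c \<noteq> -1"
  shows "(\<integral>\<^sup>+z. g (c * z) \<partial>lborel) = (\<integral>\<^sup>+z. g z \<partial>lborel)"
proof -
  have n: "(Re c)\<^sup>2 + (Im c)\<^sup>2 = 1"
    using c(1) by (simp add: cmod_def)
  have ne: "1 + Re c \<noteq> 0"
  proof
    assume "1 + Re c = 0"
    then have "Re c = -1" by simp
    with n have "c = -1" by (simp add: complex_eq_iff)
    with c show False by simp
  qed
  \<comment> \<open>This is the half-angle formula for minus the tangent of half the angle.\<close>
  define a where "a = - Im c / (1 + Re c)"
  define S where "S = (\<lambda>z. z + complex_of_real (a * Im z))"
  define T where "T = (\<lambda>z. z + \<i> * complex_of_real (Im c * Re z))"
  have [measurable]: "S \<in> borel_measurable borel" "T \<in> borel_measurable borel"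
    unfolding S_def T_def by measurable
  have a1: "1 + a * Im c = Re c"
  proof -
    have "(1 + Re c) * (1 + a * Im c) = (1 + Re c) - (Im c)\<^sup>2"
      using ne by (simp add: a_def field_simps power2_eq_square)
    also have "\<dots> = (1 + Re c) * Re c" using n by (simp add: algebra_simps power2_eq_square)
    finally show ?thesis using ne by simp
  qed
  have "a * (1 + Re c) = - Im c" 
    using ne by (simp add: a_def)
  then have a2: "a + a * Re c = - Im c" by (simp add: distrib_left)
  have eq: "c * z = S (T (S z))" for z
  proof (rule complex_eqI)
    have "Re (S (T (S z))) = (1 + a * Im c) * Re z + (a + a * (1 + a * Im c)) * Im z"
      by (simp add: S_def T_def algebra_simps)
    then show "Re (c * z) = Re (S (T (S z)))" using a1 a2 by simp
    have "Im (S (T (S z))) = Im c * Re z + (1 + a * Im c) * Im z"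
      by (simp add: S_def T_def algebra_simps)
    then show "Im (c * z) = Im (S (T (S z)))" using a1 by simp
  qed
  have "(\<integral>\<^sup>+z. g (c * z) \<partial>lborel) = (\<integral>\<^sup>+z. (\<lambda>z. g (S (T z))) (S z) \<partial>lborel)"
    by (simp add: eq)
  also have "\<dots> = (\<integral>\<^sup>+z. (\<lambda>z. g (S z)) (T z) \<partial>lborel)"
    unfolding S_def by (rule nn_integral_shear_Re) (simp add: S_def[symmetric])
  also have "\<dots> = (\<integral>\<^sup>+z. g (S z) \<partial>lborel)"
    unfolding T_def by (rule nn_integral_shear_Im) simp
  also have "\<dots> = (\<integral>\<^sup>+z. g z \<partial>lborel)"
    unfolding S_def by (rule nn_integral_shear_Re) simp
  finally show ?thesis .
qed

text \<open>
  The half turn is recovered by writing every rotation as the square of the one by its principal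
  square root, which is never \<open>-1\<close>.
\<close>

lemma nn_integral_rotate:
  fixes g :: "complex \<Rightarrow> ennreal"
  assumes g [measurable]: "g \<in> borel_measurable borel" and c: "norm c = 1"
  shows "(\<integral>\<^sup>+z. g (c * z) \<partial>lborel) = (\<integral>\<^sup>+z. g z \<partial>lborel)"
proof -
  define d where "d = csqrt c"
  have cd: "c = d * d" by (simp add: d_def flip: power2_eq_square)
  have nd: "norm d = 1" using c by (simp add: d_def)
  have "0 < Re d \<or> Re d = 0 \<and> 0 \<le> Im d" unfolding d_def by (rule csqrt_principal)
  then have d: "d \<noteq> -1" by auto
  have "(\<integral>\<^sup>+z. g (c * z) \<partial>lborel) = (\<integral>\<^sup>+z. (\<lambda>z. g (d * z)) (d * z) \<partial>lborel)"
    by (simp add: cd mult.assoc)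
  also have "\<dots> = (\<integral>\<^sup>+z. g (d * z) \<partial>lborel)"
    by (rule nn_integral_rotate_aux) (use nd d in simp_all)
  also have "\<dots> = (\<integral>\<^sup>+z. g z \<partial>lborel)"
    by (rule nn_integral_rotate_aux) (use nd d in simp_all)
  finally show ?thesis .
qed

lemma lborel_distr_rotate:
  assumes c: "norm (c :: complex) = 1"
  shows "distr lborel borel ((*) c) = lborel"
proof (rule measure_eqI)
  fix A :: "complex set" assume A: "A \<in> sets (distr lborel borel ((*) c))"
  then have [measurable]: "A \<in> sets borel" by simp
  have "emeasure (distr lborel borel ((*) c)) A = (\<integral>\<^sup>+z. indicator A z \<partial>distr lborel borel ((*) c))"
    by simp
  also have "\<dots> = (\<integral>\<^sup>+z. indicator A (c * z) \<partial>lborel)"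
    by (subst nn_integral_distr) simp_all
  also have "\<dots> = emeasure lborel A" by (subst nn_integral_rotate[OF _ c]) simp_all
  finally show "emeasure (distr lborel borel ((*) c)) A = emeasure lborel A" .
qed simp

lemma integral_rotate:
  fixes f :: "complex \<Rightarrow> complex"
  assumes [measurable]: "f \<in> borel_measurable borel" and c: "norm c = 1"
  shows "(LINT z|lborel. f (c * z)) = (LINT z|lborel. f z)"
  by (subst (2) lborel_distr_rotate[OF c, symmetric], subst integral_distr) simp_all

text \<open>
  A disc of squared radius \<open>s\<close> has area \<open>\<pi> s\<close>, so the squared modulus is uniformly distributed
  with density \<open>\<pi>\<close>. This replaces polar coordinates for radial integrands. The sign makes
  the upper half-lines, which determine a measure on the reals, have finite measure.
\<close>

lemma distr_norm_square:
  "distr (lborel :: complex measure) borel (\<lambda>z. - (norm z)\<^sup>2)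
     = density lborel (\<lambda>s. ennreal pi * indicator {..<0} s)" (is "?M = ?N")
proof (rule measure_eqI_lessThan)
  fix x :: real
  have "(\<lambda>z::complex. - (norm z)\<^sup>2) -` {x<..} = ball 0 (sqrt (max 0 (- x)))"
  proof (cases "x < 0")
    case True
    then show ?thesis by (auto simp: real_less_rsqrt power2_less_imp_less real_less_lsqrt)
       (smt (verit) norm_ge_zero real_sqrt_abs real_sqrt_less_iff)
  next
    case False
    have "- (norm z)\<^sup>2 \<le> x" for z :: complex
      using False by (smt (verit) zero_le_power2)
    then have "(\<lambda>z::complex. - (norm z)\<^sup>2) -` {x<..} = {}" by (metis (no_types, lifting) greaterThan_iff not_less vimage_eq equals0I)
    then show ?thesis using False by (simp add: max_def)
  qed
  then have "emeasure ?M {x<..} = ennreal (pi * max 0 (- x))"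
    by (simp add: emeasure_distr emeasure_ball unit_ball_vol_2 flip: ennreal_mult)
  moreover have "emeasure ?N {x<..} = ennreal (pi * max 0 (- x))"
  proof -
    have "emeasure ?N {x<..} = (\<integral>\<^sup>+s. ennreal pi * indicator {x<..<0} s \<partial>lborel)"
      by (subst emeasure_density) (auto intro!: nn_integral_cong split: split_indicator)
    also have "\<dots> = ennreal pi * emeasure lborel {x<..<0}"
      by (simp add: nn_integral_cmult)
    also have "\<dots> = ennreal (pi * max 0 (- x))"
      by (cases "x < 0") (simp_all flip: ennreal_mult)
    finally show ?thesis .
  qed
  ultimately show "emeasure ?M {x<..} = emeasure ?N {x<..}" "emeasure ?M {x<..} < \<infinity>"
    by simp_all
qed simp_all

text \<open>
  The squared norm of the \<open>k\<close>-th monomial on the disc of radius \<open>R\<close>. Over the fibre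
  \<open>R\<^sup>2 = 1 - p(w)\<close> of the ellipsoid this is where the weight \<open>(1 - p)\<^sup>k\<^sup>+\<^sup>1\<close> and the factor
  \<open>\<pi> / (k + 1)\<close> come from.
\<close>

lemma nn_integral_disc_power:
  assumes "0 \<le> R"
  shows "(\<integral>\<^sup>+z\<in>ball (0::complex) R. ennreal (norm z ^ (2 * k)) \<partial>lborel)
    = ennreal (pi * (R\<^sup>2) ^ (k + 1) / (real k + 1))"
proof -
  define g where "g s = ennreal ((- s) ^ k) * indicator {- R\<^sup>2<..} s" for s
  have [measurable]: "g \<in> borel_measurable borel" unfolding g_def by measurable
  have "(\<integral>\<^sup>+z\<in>ball (0::complex) R. ennreal (norm z ^ (2 * k)) \<partial>lborel)
      = (\<integral>\<^sup>+z. g (- (norm (z::complex))\<^sup>2) \<partial>lborel)"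
    using assms by (intro nn_integral_cong)
      (auto simp: g_def power_mult split: split_indicator intro: power2_less_imp_less power_strict_mono)
  also have "\<dots> = (\<integral>\<^sup>+s. g s \<partial>density lborel (\<lambda>s. ennreal pi * indicator {..<0} s))"
    by (subst distr_norm_square[symmetric], subst nn_integral_distr) simp_all
  also have "\<dots> = (\<integral>\<^sup>+s. ennreal pi * indicator {..<0} s * g s \<partial>lborel)"
    by (rule nn_integral_density) simp_all
  also have "\<dots> = (\<integral>\<^sup>+s. ennreal (pi * (- s) ^ k) * indicator {- R\<^sup>2..0} s \<partial>lborel)"
  proof (intro nn_integral_cong_AE)
    show "AE s in lborel. ennreal pi * indicator {..<0} s * g s
        = ennreal (pi * (- s) ^ k) * indicator {- R\<^sup>2..0} s"
      using AE_lborel_singleton[of 0] AE_lborel_singleton[of "- R\<^sup>2"]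
      by eventually_elim (auto simp: g_def ennreal_mult split: split_indicator)
  qed
  also have "\<dots> = ennreal (- pi * (- 0) ^ (k + 1) / (real k + 1) - (- pi * (- (- R\<^sup>2)) ^ (k + 1) / (real k + 1)))"
  proof (rule nn_integral_FTC_Icc)
    show "((\<lambda>s. - pi * (- s) ^ (k + 1) / (real k + 1)) has_real_derivative pi * (- s) ^ k) (at s)" for s
    proof -
      have "((\<lambda>s. (- pi / (real k + 1)) * (- s) ^ (k + 1)) has_real_derivative
          (- pi / (real k + 1)) * (real (k + 1) * (- s) ^ k * (-1))) (at s)"
        by (rule derivative_eq_intros refl | simp)+
      moreover have "(- pi / (real k + 1)) * (real (k + 1) * (- s) ^ k * (-1)) = pi * (- s) ^ k"
        by (simp add: add.commute[of 1])
      ultimately show ?thesis by simp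
    qed
  qed auto
  finally show ?thesis by simp
qed

section \<open>Taylor coefficients as integrals over discs\<close>

definition taylor_coeff :: "(complex \<Rightarrow> complex) \<Rightarrow> nat \<Rightarrow> complex" where
  "taylor_coeff h k = (deriv ^^ k) h 0 / fact k"

text \<open>
  Cauchy's formula on the unit circle for the rescaled function \<open>u \<mapsto> h (Z u)\<close>. Since the average is
  over rotations of an arbitrary point \<open>Z\<close>, and not only of a positive radius, it combines with
  rotation invariance of area without polar coordinates.
\<close>

lemma circle_average_taylor_coeff:
  assumes h: "h holomorphic_on ball 0 R" and Z: "norm Z < R"
  shows "((\<lambda>t. h (cis t * Z) * cnj (cis t) ^ k) has_integral
      of_real (2 * pi) * taylor_coeff h k * Z ^ k) {0..2*pi}"
    and "(LINT t:{0..2*pi}|lborel. h (cis t * Z) * cnj (cis t) ^ k)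
      = of_real (2 * pi) * taylor_coeff h k * Z ^ k"
proof -
  define G where "G = (\<lambda>u. h (Z * u))"
  have sub: "(*) Z ` cball 0 1 \<subseteq> ball 0 R"
  proof
    fix x assume "x \<in> (*) Z ` cball 0 1"
    then obtain u where u: "x = Z * u" "norm u \<le> 1" by (auto simp only: image_iff mem_cball_0)
    have "norm (Z * u) \<le> norm Z * 1" unfolding norm_mult using u by (intro mult_left_mono) auto
    then show "x \<in> ball 0 R" using u Z by simp
  qed
  have conth: "continuous_on (ball 0 R) h" using h by (rule holomorphic_on_imp_continuous_on)
  have contG: "continuous_on (cball 0 1) G" unfolding G_def
    by (rule continuous_on_compose2[OF conth _ sub]) (intro continuous_intros)
  have holG: "G holomorphic_on ball 0 1" unfolding G_def
    by (rule holomorphic_on_compose_gen[OF _ h, unfolded o_def])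
      (use sub in \<open>auto intro!: holomorphic_intros simp: image_subset_iff\<close>)
  have dG: "(deriv ^^ k) G 0 = Z ^ k * (deriv ^^ k) h 0" unfolding G_def
    using higher_deriv_compose_linear[OF h open_ball[of 0 1] open_ball, of 0 Z k] sub by (auto simp: image_subset_iff)
  have "((\<lambda>u. G u / (u - 0) ^ Suc k) has_contour_integral
      (2 * pi * \<i>) / fact k * (deriv ^^ k) G 0) (circlepath 0 1)"
    by (rule Cauchy_has_contour_integral_higher_derivative_circlepath[OF contG holG]) simp
  then have "((\<lambda>t. G (cis t) / cis t ^ Suc k * \<i> * cis t) has_integral
      (2 * pi * \<i>) / fact k * (deriv ^^ k) G 0) {0..2*pi}"
    unfolding circlepath_def by (subst (asm) has_contour_integral_part_circlepath_iff) simp_all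
  then have "((\<lambda>t. - \<i> * (G (cis t) / cis t ^ Suc k * \<i> * cis t)) has_integral
      - \<i> * ((2 * pi * \<i>) / fact k * (deriv ^^ k) G 0)) {0..2*pi}"
    by (rule has_integral_mult_right)
  moreover have "- \<i> * (G (cis t) / cis t ^ Suc k * \<i> * cis t) = h (cis t * Z) * cnj (cis t) ^ k" for t
  proof -
    have "inverse (cis t) = cnj (cis t)" by (simp add: cis_cnj)
    then have "cnj (cis t) ^ k = 1 / cis t ^ k" by (metis inverse_eq_divide power_inverse)
    then show ?thesis by (simp add: G_def mult.commute)
  qed
  moreover have "- \<i> * ((2 * pi * \<i>) / fact k * (deriv ^^ k) G 0)
      = of_real (2 * pi) * taylor_coeff h k * Z ^ k"
    by (simp add: dG taylor_coeff_def field_simps)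
  ultimately show *: "((\<lambda>t. h (cis t * Z) * cnj (cis t) ^ k) has_integral
      of_real (2 * pi) * taylor_coeff h k * Z ^ k) {0..2*pi}" by simp
  have "continuous_on {0..2*pi} (\<lambda>t. h (cis t * Z) * cnj (cis t) ^ k)"
    by (intro continuous_intros continuous_on_compose2[OF conth]) (use Z in \<open>auto simp: norm_mult\<close>)
  then have "set_integrable lborel {0..2*pi} (\<lambda>t. h (cis t * Z) * cnj (cis t) ^ k)"
    by (rule borel_integrable_atLeastAtMost')
  then show "(LINT t:{0..2*pi}|lborel. h (cis t * Z) * cnj (cis t) ^ k)
      = of_real (2 * pi) * taylor_coeff h k * Z ^ k"
    using * by (simp add: set_borel_integral_eq_integral(2) integral_unique)
qed

lemma has_bochner_integral_disc_power:
  assumes "0 \<le> R"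
  shows "has_bochner_integral lborel (\<lambda>z::complex. indicator (ball 0 R) z * norm z ^ (2 * k))
    (pi * (R\<^sup>2) ^ (k + 1) / (real k + 1))"
proof (rule has_bochner_integral_nn_integral)
  show "(\<integral>\<^sup>+z. ennreal (indicator (ball 0 R) z * norm (z::complex) ^ (2 * k)) \<partial>lborel)
      = ennreal (pi * (R\<^sup>2) ^ (k + 1) / (real k + 1))"
    unfolding nn_integral_disc_power[OF assms, symmetric]
    by (intro nn_integral_cong) (auto split: split_indicator)
  have [measurable]: "ball (0::complex) R \<in> sets borel" by simp
  show "(\<lambda>z::complex. indicator (ball 0 R) z * norm z ^ (2 * k)) \<in> borel_measurable lborel"
    by measurable
qed auto

lemma set_integrable_disc_times_power:
  assumes h: "set_integrable lborel (ball 0 R) (h :: complex \<Rightarrow> complex)"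
  shows "set_integrable lborel (ball 0 R) (\<lambda>z. h z * cnj z ^ k)"
proof -
  have hi: "integrable lborel (\<lambda>z. indicator (ball 0 R) z *\<^sub>R h z)"
    using h by (simp add: set_integrable_def)
  have eq: "indicator (ball 0 R) z *\<^sub>R (h z * cnj z ^ k) = (indicator (ball 0 R) z *\<^sub>R h z) * cnj z ^ k" for z
    by simp
  have "integrable lborel (\<lambda>z. (indicator (ball 0 R) z *\<^sub>R h z) * cnj z ^ k)"
  proof (rule Bochner_Integration.integrable_bound)
    show "integrable lborel (\<lambda>z. R ^ k *\<^sub>R (indicator (ball 0 R) z *\<^sub>R h z))"
      using hi by (intro integrable_scaleR_right) simp
    show "(\<lambda>z. (indicator (ball 0 R) z *\<^sub>R h z) * cnj z ^ k) \<in> borel_measurable lborel"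
    proof -
      have [measurable]: "(\<lambda>z. indicator (ball 0 R) z *\<^sub>R h z) \<in> borel_measurable lborel"
        using hi by (rule borel_measurable_integrable)
      have [measurable]: "(\<lambda>z. cnj z ^ k) \<in> borel_measurable borel"
        by (intro borel_measurable_continuous_onI continuous_intros)
      show ?thesis by measurable
    qed
    show "AE z in lborel. norm (indicator (ball 0 R) z *\<^sub>R h z * cnj z ^ k)
        \<le> norm (R ^ k *\<^sub>R indicator (ball 0 R) z *\<^sub>R h z)"
      by (rule AE_I2) (auto simp: norm_mult norm_power mult.commute abs_of_nonneg
          intro!: mult_left_mono power_mono order_trans[OF power_mono abs_ge_self] split: split_indicator)
  qed
  then show ?thesis by (simp add: set_integrable_def)
qed

text \<open>
  The integral over the disc does not change when its argument is rotated, hence it equals its mean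
  over all rotations. By Fubini the mean may be taken first, and it replaces \<open>h z\<close> by the single
  term \<open>taylor_coeff h k * z ^ k\<close>. This avoids integrating the power series term by
  term, as it need not converge uniformly up to the boundary.
\<close>

lemma disc_integral_eq_taylor_coeff:
  assumes h: "h holomorphic_on ball 0 R" and R: "0 \<le> R"
    and hi: "set_integrable lborel (ball 0 R) h"
  shows "(LINT z:ball 0 R|lborel. h z * cnj z ^ k)
    = taylor_coeff h k * of_real (pi * (R\<^sup>2) ^ (k + 1) / (real k + 1))"
proof -
  define f where "f z = indicator (ball 0 R) z *\<^sub>R (h z * cnj z ^ k)" for z
  have fi: "integrable lborel f"
    using set_integrable_disc_times_power[OF hi] by (simp add: f_def[abs_def] set_integrable_def)
  then have fm [measurable]: "f \<in> borel_measurable borel" by simp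
  \<comment> \<open>The rotated integrand as a function of the angle and the point, for Fubini.\<close>
  define P where "P = (\<lambda>(t, z). indicator {0..2*pi} t *\<^sub>R f (cis t * z))"
  have [measurable]: "cis \<in> borel_measurable borel"
    by (intro borel_measurable_continuous_onI continuous_intros)
  have Pm: "P \<in> borel_measurable (lborel \<Otimes>\<^sub>M lborel)"
    unfolding P_def by measurable
  have rot_norm: "(LINT z|lborel. norm (f (cis t * z))) = (LINT z|lborel. norm (f z))" for t
  proof -
    have "(LINT z|lborel. norm (f z)) = (LINT z|distr lborel borel ((*) (cis t)). norm (f z))"
      by (subst lborel_distr_rotate) simp_all
    also have "\<dots> = (LINT z|lborel. norm (f (cis t * z)))"
      by (subst integral_distr) simp_all
    finally show ?thesis by simp
  qed
  have rot_int: "integrable lborel (\<lambda>z. f (cis t * z))" for t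
  proof -
    have "integrable (distr lborel borel ((*) (cis t))) f"
      using fi by (subst lborel_distr_rotate) simp_all
    then show ?thesis by (subst (asm) integrable_distr_eq) simp_all
  qed
  have Pi: "integrable (lborel \<Otimes>\<^sub>M lborel) P"
  proof (rule lborel_pair.Fubini_integrable[OF Pm])
    have "(\<lambda>t. LINT z|lborel. norm (P (t, z)))
        = (\<lambda>t. indicator {0..2*pi} t *\<^sub>R (LINT z|lborel. norm (f z)))"
      by (auto simp: P_def rot_norm split: split_indicator)
    then show "integrable lborel (\<lambda>t. LINT z|lborel. norm (P (t, z)))"
      by (simp add: integrable_mult_left)
    show "AE t in lborel. integrable lborel (\<lambda>z. P (t, z))"
      unfolding P_def using rot_int by auto
  qed
  have "(LINT t|lborel. LINT z|lborel. indicator {0..2*pi} t *\<^sub>R f (cis t * z))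
      = (LINT t|lborel. indicator {0..2*pi} t *\<^sub>R (LINT z|lborel. f z))"
    by (simp add: integral_rotate)
  also have "\<dots> = of_real (2 * pi) * (LINT z|lborel. f z)"
    by (subst Bochner_Integration.integral_scaleR_left) (simp_all add: scaleR_conv_of_real)
  finally have A: "(LINT t|lborel. LINT z|lborel. indicator {0..2*pi} t *\<^sub>R f (cis t * z))
      = of_real (2 * pi) * (LINT z|lborel. f z)" .
  have inner: "(LINT t|lborel. indicator {0..2*pi} t *\<^sub>R f (cis t * z))
      = of_real (2 * pi) * taylor_coeff h k * of_real (indicator (ball 0 R) z * norm z ^ (2 * k))" for z
  proof (cases "z \<in> ball 0 R")
    case True
    have "(LINT t|lborel. indicator {0..2*pi} t *\<^sub>R f (cis t * z))
        = (LINT t|lborel. (indicator {0..2*pi} t *\<^sub>R (h (cis t * z) * cnj (cis t) ^ k)) * cnj z ^ k)"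
      using True by (intro Bochner_Integration.integral_cong)
        (auto simp: f_def norm_mult power_mult_distrib split: split_indicator)
    also have "\<dots> = (LINT t:{0..2*pi}|lborel. h (cis t * z) * cnj (cis t) ^ k) * cnj z ^ k"
      by (simp only: set_lebesgue_integral_def integral_mult_left_zero)
    also have "\<dots> = of_real (2 * pi) * taylor_coeff h k * (z ^ k * cnj z ^ k)"
      using True by (subst circle_average_taylor_coeff(2)[OF h]) auto
    also have "z ^ k * cnj z ^ k = of_real (norm z ^ (2 * k))"
      by (metis complex_norm_square of_real_power power_mult power_mult_distrib)
    finally show ?thesis using True by simp
  next
    case False
    then have "f (cis t * z) = 0" for t by (simp add: f_def norm_mult)
    then show ?thesis using False by simp
  qed
  have "(LINT z|lborel. LINT t|lborel. indicator {0..2*pi} t *\<^sub>R f (cis t * z))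
      = of_real (2 * pi) * taylor_coeff h k * of_real (pi * (R\<^sup>2) ^ (k + 1) / (real k + 1))"
    unfolding inner
    using has_bochner_integral_integral_eq[OF has_bochner_integral_disc_power[OF R, of k]]
    by (simp add: integral_mult_right_zero del: of_real_mult)
  moreover have "(LINT z|lborel. LINT t|lborel. indicator {0..2*pi} t *\<^sub>R f (cis t * z))
      = (LINT t|lborel. LINT z|lborel. indicator {0..2*pi} t *\<^sub>R f (cis t * z))"
    using Pi unfolding P_def by (rule lborel_pair.Fubini_integral)
  ultimately have "of_real (2 * pi) * (LINT z|lborel. f z)
    = of_real (2 * pi) * (taylor_coeff h k * of_real (pi * (R\<^sup>2) ^ (k + 1) / (real k + 1)))"
    using A by (simp only: mult.assoc)
  then have "(LINT z|lborel. f z) = taylor_coeff h k * of_real (pi * (R\<^sup>2) ^ (k + 1) / (real k + 1))"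
    by (subst (asm) mult_cancel_left) simp
  then show ?thesis by (simp add: f_def[abs_def] set_lebesgue_integral_def)
qed

text \<open>
  Square integrable functions on a disc are integrable because the disc has finite area.
\<close>

lemma set_integrable_disc_if_square:
  fixes h :: "complex \<Rightarrow> complex"
  assumes h: "h holomorphic_on ball 0 R"
    and fin: "(\<integral>\<^sup>+z\<in>ball 0 R. ennreal ((norm (h z))\<^sup>2) \<partial>lborel) < \<infinity>"
  shows "set_integrable lborel (ball 0 R) (\<lambda>z. (norm (h z))\<^sup>2)"
    and "set_integrable lborel (ball 0 R) h"
proof -
  have conth: "continuous_on (ball 0 R) h" using h by (rule holomorphic_on_imp_continuous_on)
  have m: "(\<lambda>z. indicator (ball 0 R) z *\<^sub>R h z) \<in> borel_measurable lborel"
    using borel_measurable_continuous_on_indicator[OF _ conth] by simp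
  have m2: "(\<lambda>z. indicator (ball 0 R) z *\<^sub>R (norm (h z))\<^sup>2) \<in> borel_measurable lborel"
    using borel_measurable_continuous_on_indicator[of "ball 0 R" "\<lambda>z. (norm (h z))\<^sup>2"] conth
    by (simp add: continuous_intros)
  show sq: "set_integrable lborel (ball 0 R) (\<lambda>z. (norm (h z))\<^sup>2)"
    unfolding set_integrable_def
  proof (rule integrableI_bounded[OF m2])
    have "(\<integral>\<^sup>+z. ennreal (norm (indicator (ball 0 R) z *\<^sub>R (norm (h z))\<^sup>2)) \<partial>lborel)
        = (\<integral>\<^sup>+z\<in>ball 0 R. ennreal ((norm (h z))\<^sup>2) \<partial>lborel)"
      by (intro nn_integral_cong) (auto split: split_indicator)
    then show "(\<integral>\<^sup>+z. ennreal (norm (indicator (ball 0 R) z *\<^sub>R (norm (h z))\<^sup>2)) \<partial>lborel) < \<infinity>"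
      using fin by simp
  qed
  have "integrable lborel (\<lambda>z. indicat_real (ball 0 R) z + indicator (ball 0 R) z *\<^sub>R (norm (h z))\<^sup>2)"
    using sq emeasure_lborel_ball_finite[of "0::complex" R]
    by (auto simp: set_integrable_def less_top intro!: Bochner_Integration.integrable_add)
  then show "set_integrable lborel (ball 0 R) h"
    unfolding set_integrable_def
  proof (rule Bochner_Integration.integrable_bound[OF _ m], intro AE_I2)
    fix z
    have "norm (h z) \<le> 1 + (norm (h z))\<^sup>2"
      by (smt (verit) norm_ge_zero self_le_power power_le_one zero_le_power2 zero_less_numeral)
    then show "norm (indicator (ball 0 R) z *\<^sub>R h z)
        \<le> norm (indicat_real (ball 0 R) z + indicator (ball 0 R) z *\<^sub>R (norm (h z))\<^sup>2)"
      by (auto split: split_indicator)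
  qed
qed

text \<open>
  Bessel's inequality for one monomial: expand the nonnegative integral of
  \<open>(norm (h z - taylor_coeff h k * z ^ k))\<^sup>2\<close>.
\<close>

lemma disc_bessel:
  assumes h: "h holomorphic_on ball 0 R" and R: "0 \<le> R"
  shows "ennreal ((norm (taylor_coeff h k))\<^sup>2 * (pi * (R\<^sup>2) ^ (k + 1) / (real k + 1)))
    \<le> (\<integral>\<^sup>+z\<in>ball 0 R. ennreal ((norm (h z))\<^sup>2) \<partial>lborel)"
proof (cases "(\<integral>\<^sup>+z\<in>ball 0 R. ennreal ((norm (h z))\<^sup>2) \<partial>lborel) < \<infinity>")
  case False
  then show ?thesis by (simp add: less_top[symmetric])
next
  case True
  note int = set_integrable_disc_if_square[OF h True]
  define a where "a = taylor_coeff h k"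
  define c where "c = pi * (R\<^sup>2) ^ (k + 1) / (real k + 1)"
  define I where "I = (LINT z:ball 0 R|lborel. (norm (h z))\<^sup>2)"
  have bh: "has_bochner_integral lborel (\<lambda>z. indicator (ball 0 R) z *\<^sub>R (norm (h z))\<^sup>2) I"
    using int(1) unfolding I_def set_integrable_def set_lebesgue_integral_def
    by (rule has_bochner_integral_integrable)
  have "has_bochner_integral lborel (\<lambda>z. indicator (ball 0 R) z *\<^sub>R (h z * cnj z ^ k)) (a * of_real c)"
    using has_bochner_integral_integrable[OF set_integrable_disc_times_power[OF int(2), of k,
          unfolded set_integrable_def]]
    unfolding a_def c_def disc_integral_eq_taylor_coeff[OF h R int(2), symmetric]
      set_lebesgue_integral_def .
  then have "has_bochner_integral lborel
      (\<lambda>z. Re (cnj a * (indicator (ball 0 R) z *\<^sub>R (h z * cnj z ^ k)))) (Re (cnj a * (a * of_real c)))"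
    by (intro has_bochner_integral_bounded_linear[OF bounded_linear_Re] has_bochner_integral_mult_right)
  from has_bochner_integral_diff[OF has_bochner_integral_add[OF bh
        has_bochner_integral_mult_right[OF has_bochner_integral_disc_power[OF R, of k, folded c_def], of "(norm a)\<^sup>2"]]
      has_bochner_integral_mult_right[OF this, of 2]]
  have B: "has_bochner_integral lborel
     (\<lambda>z. indicator (ball 0 R) z *\<^sub>R (norm (h z))\<^sup>2 + (norm a)\<^sup>2 * (indicator (ball 0 R) z * norm z ^ (2 * k))
         - 2 * Re (cnj a * (indicator (ball 0 R) z *\<^sub>R (h z * cnj z ^ k))))
     (I + (norm a)\<^sup>2 * c - 2 * Re (cnj a * (a * of_real c)))" by blast
  have pt: "indicator (ball 0 R) z *\<^sub>R (norm (h z))\<^sup>2 + (norm a)\<^sup>2 * (indicator (ball 0 R) z * norm z ^ (2 * k))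
         - 2 * Re (cnj a * (indicator (ball 0 R) z *\<^sub>R (h z * cnj z ^ k)))
      = indicator (ball 0 R) z * (norm (h z - a * z ^ k))\<^sup>2" for z
  proof -
    have "(norm (x - y))\<^sup>2 = (norm x)\<^sup>2 + (norm y)\<^sup>2 - 2 * Re (cnj y * x)" for x y :: complex
      by (simp only: cmod_power2) (simp add: power2_eq_square algebra_simps)
    from this[of "h z" "a * z ^ k"] show ?thesis
      by (auto simp: norm_mult norm_power power_mult_distrib power_mult[symmetric] mult_ac split: split_indicator)
  qed
  have "0 \<le> I + (norm a)\<^sup>2 * c - 2 * Re (cnj a * (a * of_real c))"
    using B unfolding pt has_bochner_integral_iff by (metis (no_types, lifting) Bochner_Integration.integral_nonneg
        indicator_pos_le mult_nonneg_nonneg zero_le_power2)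
  moreover have "Re (cnj a * (a * of_real c)) = (norm a)\<^sup>2 * c"
    unfolding cmod_power2 by (simp add: power2_eq_square algebra_simps)
  ultimately have "(norm a)\<^sup>2 * c \<le> I" by simp
  moreover have "(\<integral>\<^sup>+z\<in>ball 0 R. ennreal ((norm (h z))\<^sup>2) \<partial>lborel) = ennreal I"
  proof -
    have "(\<integral>\<^sup>+z\<in>ball 0 R. ennreal ((norm (h z))\<^sup>2) \<partial>lborel)
      = (\<integral>\<^sup>+z. ennreal (indicator (ball 0 R) z *\<^sub>R (norm (h z))\<^sup>2) \<partial>lborel)"
      by (intro nn_integral_cong) (auto split: split_indicator)
    also have "\<dots> = ennreal I"
      using bh by (subst nn_integral_eq_integral) (auto simp: has_bochner_integral_iff)
    finally show ?thesis .
  qed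
  ultimately show ?thesis unfolding a_def c_def by (simp add: ennreal_leI)
qed

section \<open>Holomorphic parameter integrals\<close>

text \<open>
  Morera's theorem: integrals over triangles may be taken under the parameter integral, where they
  vanish by Cauchy's theorem. The parameter integral is written as a contour integral along a real
  segment, so that the exchange is an instance of the one for two contours.
\<close>

lemma holomorphic_on_integral_param:
  fixes \<Phi> :: "complex \<Rightarrow> real \<Rightarrow> complex"
  assumes S: "open S" and ab: "a < b"
    and cont: "continuous_on (S \<times> {a..b}) (\<lambda>(x, t). \<Phi> x t)"
    and hol: "\<And>t. t \<in> {a..b} \<Longrightarrow> (\<lambda>x. \<Phi> x t) holomorphic_on S"
  shows "(\<lambda>x. integral {a..b} (\<Phi> x)) holomorphic_on S"
proof -
  define L where "L = linepath (complex_of_real a) (complex_of_real b)"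
  have path: "Re y \<in> {a..b} \<and> y = of_real (Re y)" if "y \<in> path_image L" for y
    using that ab unfolding L_def path_image_linepath
    by (auto simp: closed_segment_of_real closed_segment_eq_real_ivl)
  have LI: "contour_integral L (\<lambda>y. \<Phi> x (Re y)) = integral {a..b} (\<Phi> x)" for x
    unfolding L_def using ab by (subst contour_integral_linepath_Reals_eq) auto
  have contG: "continuous_on S (\<lambda>x. integral {a..b} (\<Phi> x))"
    using integral_continuous_on_param[of S a b \<Phi>] cont by simp
  have swap: "contour_integral (linepath p q) (\<lambda>x. integral {a..b} (\<Phi> x))
      = contour_integral L (\<lambda>y. contour_integral (linepath p q) (\<lambda>x. \<Phi> x (Re y)))"
    if "closed_segment p q \<subseteq> S" for p q
    unfolding LI[symmetric]
  proof (rule contour_integral_swap)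
    have "continuous_on (path_image (linepath p q) \<times> path_image L)
        ((\<lambda>(x, t). \<Phi> x t) \<circ> (\<lambda>(x, y). (x, Re y)))"
    proof (rule continuous_on_compose)
      show "continuous_on (path_image (linepath p q) \<times> path_image L) (\<lambda>(x, y). (x, Re y))"
        unfolding case_prod_unfold by (intro continuous_intros)
      show "continuous_on ((\<lambda>(x, y). (x, Re y)) ` (path_image (linepath p q) \<times> path_image L)) (\<lambda>(x, t). \<Phi> x t)"
        by (rule continuous_on_subset[OF cont]) (use that path in force)
    qed
    then show "continuous_on (path_image (linepath p q) \<times> path_image L) (\<lambda>(y1, y2). \<Phi> y1 (Re y2))"
      by (simp add: o_def case_prod_unfold)
  qed (auto simp: L_def)
  have "(\<lambda>x. integral {a..b} (\<Phi> x)) analytic_on S"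
  proof (rule Morera_triangle[OF contG S], intro impI)
    fix p q r assume sub: "convex hull {p, q, r} \<subseteq> S"
    have seg: "closed_segment p q \<subseteq> S" "closed_segment q r \<subseteq> S" "closed_segment r p \<subseteq> S"
      by (rule order_trans[OF segments_subset_convex_hull(1) sub]
          order_trans[OF segments_subset_convex_hull(3) sub]
          order_trans[OF segments_subset_convex_hull(5) sub])+
    have ci: "(\<lambda>y. contour_integral (linepath s u) (\<lambda>x. \<Phi> x (Re y))) contour_integrable_on L"
      if su: "closed_segment s u \<subseteq> S" for s u
    proof -
      have "continuous_on {a..b} (\<lambda>t. integral {0..1} (\<lambda>v. \<Phi> (linepath s u v) t * (u - s)))"
      proof -
        have c: "continuous_on ({a..b} \<times> {0..1}) (\<lambda>z. (linepath s u (snd z), fst z))"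
          unfolding linepath_def by (intro continuous_intros)
        have "(\<lambda>z. (linepath s u (snd z), fst z)) ` ({a..b} \<times> {0..1}) \<subseteq> S \<times> {a..b}"
        proof (rule image_subsetI)
          fix z :: "real \<times> real" assume "z \<in> {a..b} \<times> {0..1}"
          then have "fst z \<in> {a..b}" "snd z \<in> {0..1}" by (simp_all add: mem_Times_iff)
          then show "(linepath s u (snd z), fst z) \<in> S \<times> {a..b}"
            using su linepath_in_path[of "snd z" s u] by blast
        qed
        from continuous_on_compose2[OF cont c this]
        have "continuous_on ({a..b} \<times> {0..1}) (\<lambda>z. \<Phi> (linepath s u (snd z)) (fst z) * (u - s))"
          by (intro continuous_intros) simp
        then show ?thesis
          using integral_continuous_on_param[of "{a..b}" 0 1 "\<lambda>t v. \<Phi> (linepath s u v) t * (u - s)"]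
          by (simp add: case_prod_unfold)
      qed
      then have "continuous_on (path_image L) (\<lambda>y. contour_integral (linepath s u) (\<lambda>x. \<Phi> x (Re y)))"
        unfolding contour_integral_integral vector_derivative_linepath_at
      proof (rule continuous_on_compose2)
        show "continuous_on (path_image L) Re" by (intro continuous_intros)
        show "Re ` path_image L \<subseteq> {a..b}" using path by blast
      qed
      then show ?thesis unfolding L_def by (intro contour_integrable_continuous_linepath) simp
    qed
    have zero: "contour_integral (linepath p q) (\<lambda>x. \<Phi> x t) + contour_integral (linepath q r) (\<lambda>x. \<Phi> x t)
        + contour_integral (linepath r p) (\<lambda>x. \<Phi> x t) = 0" if "t \<in> {a..b}" for t
    proof -
      have h: "(\<lambda>x. \<Phi> x t) holomorphic_on convex hull {p, q, r}"
        using hol[OF that] sub by (rule holomorphic_on_subset)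
      have c: "continuous_on S (\<lambda>x. \<Phi> x t)" by (rule holomorphic_on_imp_continuous_on[OF hol[OF that]])
      have i: "(\<lambda>x. \<Phi> x t) contour_integrable_on linepath s u" if "closed_segment s u \<subseteq> S" for s u
        by (intro contour_integrable_continuous_linepath continuous_on_subset[OF c] that)
      have "((\<lambda>x. \<Phi> x t) has_contour_integral 0) (linepath p q +++ linepath q r +++ linepath r p)"
        by (rule Cauchy_theorem_triangle[OF h])
      then have "contour_integral (linepath p q +++ linepath q r +++ linepath r p) (\<lambda>x. \<Phi> x t) = 0"
        by (rule contour_integral_unique)
      then show ?thesis using i seg by (simp add: contour_integrable_joinI add.assoc)
    qed
    let ?J = "\<lambda>s u y. contour_integral (linepath s u) (\<lambda>x. \<Phi> x (Re y))"
    have "contour_integral L (?J p q) + contour_integral L (?J q r) + contour_integral L (?J r p)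
        = contour_integral L (\<lambda>y. ?J p q y + ?J q r y + ?J r p y)"
      using ci seg by (simp add: contour_integral_add contour_integrable_add)
    also have "\<dots> = contour_integral L (\<lambda>y. 0)"
      by (rule contour_integral_eq) (use path zero in auto)
    finally show "contour_integral (linepath p q) (\<lambda>x. integral {a..b} (\<Phi> x))
        + contour_integral (linepath q r) (\<lambda>x. integral {a..b} (\<Phi> x))
        + contour_integral (linepath r p) (\<lambda>x. integral {a..b} (\<Phi> x)) = 0"
      using seg by (simp add: swap)
  qed
  then show ?thesis by (rule analytic_imp_holomorphic)
qed

section \<open>Relatively open sets and Lebesgue measure on finite-dimensional complex space\<close>

abbreviation openin_cspace :: "nat set \<Rightarrow> point set \<Rightarrow> bool" where
  "openin_cspace I U \<equiv> openin (top_of_set (cspace I)) U"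

lemma mem_cspace_iff: "v \<in> cspace I \<longleftrightarrow> (\<forall>i. i \<notin> I \<longrightarrow> v i = undefined)"
  by (auto simp: cspace_def PiE_def extensional_def)

lemma space_leb: "space (leb I) = cspace I"
  by (simp add: leb_def space_PiM cspace_def)

lemma closed_cspace: "closed (cspace I)"
proof -
  have "cspace I = (\<Inter>i\<in>- I. {v. v i = undefined})"
    by (auto simp: mem_cspace_iff)
  moreover have "closed {v :: point. v i = undefined}" for i
    by (intro closed_Collect_eq continuous_on_product_coordinates continuous_on_const)
  ultimately show ?thesis by auto
qed

text \<open>
  The product measure lives on \<open>cspace I\<close>, while continuity refers to all functions on the natural
  numbers. Measurability of the inclusion, whose coordinates outside \<open>I\<close> are constant, turns
  continuous functions into measurable ones.
\<close>

lemma measurable_leb_borel: "(\<lambda>v. v) \<in> leb I \<rightarrow>\<^sub>M borel"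
proof (rule measurable_coordinatewise_then_product)
  fix i
  show "(\<lambda>v. v i) \<in> borel_measurable (leb I)"
  proof (cases "i \<in> I")
    case True
    then show ?thesis unfolding leb_def
      using measurable_component_singleton[of i I "\<lambda>_. lborel"] by simp
  next
    case False
    then have "v i = undefined" if "v \<in> space (leb I)" for v
      using that by (auto simp: space_leb mem_cspace_iff)
    then show ?thesis by (subst measurable_cong[where g = "\<lambda>_. undefined"]) auto
  qed
qed

lemma openin_cspace_borel: "openin_cspace I U \<Longrightarrow> U \<in> sets borel"
  using borel_closed[OF closed_cspace] by (auto simp: openin_open intro!: sets.Int)

lemma openin_cspace_subset: "openin_cspace I U \<Longrightarrow> U \<subseteq> cspace I"
  by (drule openin_imp_subset)

lemma sets_leb_openin:
  assumes "openin_cspace I U" shows "U \<in> sets (leb I)"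
proof -
  have "(\<lambda>v. v) -` U \<inter> space (leb I) \<in> sets (leb I)"
    by (rule measurable_sets[OF measurable_leb_borel openin_cspace_borel[OF assms]])
  moreover have "(\<lambda>v. v) -` U \<inter> space (leb I) = U"
    using openin_cspace_subset[OF assms] by (auto simp: space_leb)
  ultimately show ?thesis by simp
qed

lemma borel_measurable_leb_continuous:
  fixes f :: "point \<Rightarrow> 'a::real_normed_vector"
  assumes "openin_cspace I U" "continuous_on U f"
  shows "(\<lambda>v. indicator U v *\<^sub>R f v) \<in> borel_measurable (leb I)"
  using measurable_compose[OF measurable_leb_borel
      borel_measurable_continuous_on_indicator[OF openin_cspace_borel[OF assms(1)] assms(2)]] .

lemma borel_measurable_leb_continuous_ennreal:
  fixes f :: "point \<Rightarrow> real"
  assumes "openin_cspace I U" "continuous_on U f"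
  shows "(\<lambda>v. ennreal (f v) * indicator U v) \<in> borel_measurable (leb I)"
proof -
  have "(\<lambda>v. ennreal (indicator U v *\<^sub>R f v)) \<in> borel_measurable (leb I)"
    by (rule measurable_compose[OF borel_measurable_leb_continuous[OF assms] measurable_ennreal])
  moreover have "ennreal (indicator U v *\<^sub>R f v) = ennreal (f v) * indicator U v" for v
    by (simp split: split_indicator)
  ultimately show ?thesis by (simp only:)
qed

text \<open>
  A basic open box of the full product topology restricts to a box in the coordinates in \<open>I\<close>: points
  of \<open>cspace I\<close> agree with \<open>v\<close> in the others.
\<close>

lemma openin_cspace_contains_box:
  assumes U: "openin_cspace I U" and v: "v \<in> U"
  obtains X where "\<And>i. open (X i)" "\<And>i. v i \<in> X i" "(\<Pi>\<^sub>E i\<in>I. X i) \<subseteq> U"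
proof -
  obtain T where T: "open T" "U = cspace I \<inter> T" using U by (auto simp: openin_open)
  have "openin (product_topology (\<lambda>i. euclidean) UNIV) T" using T(1) by (simp add: open_fun_def)
  from product_topology_open_contains_basis[OF this, of v] v T
  have "\<exists>X. v \<in> (\<Pi>\<^sub>E i\<in>UNIV. X i) \<and> (\<forall>i. open (X i)) \<and> finite {i. X i \<noteq> UNIV} \<and> (\<Pi>\<^sub>E i\<in>UNIV. X i) \<subseteq> T"
    by simp
  then obtain X where X: "v \<in> (\<Pi>\<^sub>E i\<in>UNIV. X i)" "\<And>i. open (X i)" "(\<Pi>\<^sub>E i\<in>UNIV. X i) \<subseteq> T"
    by blast
  have "(\<Pi>\<^sub>E i\<in>I. X i) \<subseteq> U"
  proof
    fix x assume x: "x \<in> (\<Pi>\<^sub>E i\<in>I. X i)"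
    then have xc: "x \<in> cspace I" by (auto simp: mem_cspace_iff PiE_def extensional_def)
    moreover have "x i \<in> X i" for i
    proof (cases "i \<in> I")
      case False
      then have "x i = v i" using xc v T by (auto simp: mem_cspace_iff)
      then show ?thesis using X(1) by auto
    qed (use x in auto)
    then have "x \<in> T" using X(3) by (auto simp: PiE_UNIV_domain)
    ultimately show "x \<in> U" using T by simp
  qed
  with X show ?thesis by (intro that[of X]) auto
qed

lemma product_sigma_finite_lborel: "product_sigma_finite (\<lambda>_::nat. lborel :: complex measure)"
  by standard

lemma emeasure_leb_pos:
  assumes I: "finite I" and U: "openin_cspace I U" and v: "v \<in> U"
  shows "emeasure (leb I) U > 0"
proof -
  obtain X where X: "\<And>i. open (X i)" "\<And>i. v i \<in> X i" "(\<Pi>\<^sub>E i\<in>I. X i) \<subseteq> U"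
    using openin_cspace_contains_box[OF U v] by blast
  interpret product_sigma_finite "\<lambda>_::nat. lborel :: complex measure"
    by (rule product_sigma_finite_lborel)
  have "emeasure (leb I) (\<Pi>\<^sub>E i\<in>I. X i) = (\<Prod>i\<in>I. emeasure lborel (X i))"
    unfolding leb_def using X(1) I by (intro emeasure_PiM) auto
  moreover have "(\<Prod>i\<in>I. emeasure lborel (X i)) \<noteq> 0"
  proof -
    have "emeasure lborel (X i) \<noteq> 0" for i
    proof
      assume "emeasure lborel (X i) = 0"
      then have "X i \<in> null_sets lborel" using X(1) by (simp add: null_sets_def)
      then have "negligible (X i)" by (simp add: negligible_iff_null_sets null_sets_completionI)
      then show False using open_not_negligible[OF X(1)] X(2) by blast
    qed
    then show ?thesis using I by (simp add: prod_zero_iff)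
  qed
  moreover have "emeasure (leb I) (\<Pi>\<^sub>E i\<in>I. X i) \<le> emeasure (leb I) U"
    by (intro emeasure_mono X sets_leb_openin[OF U])
  ultimately show ?thesis by (metis not_gr_zero order_less_le_trans)
qed

lemma continuous_on_fun_upd:
  fixes f :: "'a::topological_space \<Rightarrow> point"
  assumes "continuous_on A f" "continuous_on A g"
  shows "continuous_on A (\<lambda>x. (f x)(i := g x))"
proof (rule continuous_on_coordinatewise_then_product)
  fix j show "continuous_on A (\<lambda>x. ((f x)(i := g x)) j)"
    using assms continuous_on_product_then_coordinatewise[OF assms(1), of j]
    by (cases "j = i") simp_all
qed

lemma open_coordinate_slice:
  assumes U: "openin_cspace I U" and v: "v \<in> cspace I" and i: "i \<in> I"
  shows "open {t. v(i := t) \<in> U}"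
proof -
  obtain T where T: "open T" "U = cspace I \<inter> T" using U by (auto simp: openin_open)
  have "{t. v(i := t) \<in> U} = (\<lambda>t. v(i := t)) -` T"
    using v i by (auto simp: T(2) mem_cspace_iff)
  also have "open \<dots>"
    by (intro open_vimage T continuous_on_fun_upd continuous_on_const continuous_on_id)
  finally show ?thesis .
qed


section \<open>Holomorphic functions of several variables\<close>

lemma holomorphic_several_slice:
  assumes f: "holomorphic_several I f \<Omega>" and i: "i \<in> I"
  shows "(\<lambda>t. f (v(i := t))) holomorphic_on {t. v(i := t) \<in> \<Omega>}"
proof -
  have "(\<lambda>t. f (v(i := t))) field_differentiable at x" if "v(i := x) \<in> \<Omega>" for x
    using f that i unfolding holomorphic_several_def by fastforce
  then show ?thesis
    by (auto simp: holomorphic_on_def intro: field_differentiable_at_within)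
qed

lemma holomorphic_several_mult_const:
  assumes "holomorphic_several I f U"
  shows "holomorphic_several I (\<lambda>v. f v * c) U"
  using assms unfolding holomorphic_several_def
  by (simp add: continuous_on_mult_right field_differentiable_mult)

lemma holomorphic_several_integral_param:
  fixes g :: "point \<Rightarrow> real \<Rightarrow> complex"
  assumes U: "openin_cspace I U" and ab: "a < b"
    and cont: "continuous_on (U \<times> {a..b}) (\<lambda>(v, t). g v t)"
    and hol: "\<And>t. t \<in> {a..b} \<Longrightarrow> holomorphic_several I (\<lambda>v. g v t) U"
  shows "holomorphic_several I (\<lambda>v. integral {a..b} (g v)) U"
  unfolding holomorphic_several_def
proof (intro conjI ballI)
  show "continuous_on U (\<lambda>v. integral {a..b} (g v))"
    using integral_continuous_on_param[of U a b g] cont by simp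
next
  fix v i assume v: "v \<in> U" and i: "i \<in> I"
  define S where "S = {x. v(i := x) \<in> U}"
  have S: "open S" unfolding S_def
    using open_coordinate_slice[OF U _ i] v openin_cspace_subset[OF U] by blast
  have c: "continuous_on (S \<times> {a..b}) (\<lambda>z. (v(i := fst z), snd z))"
    by (intro continuous_on_Pair continuous_on_fun_upd continuous_on_const continuous_on_fst
        continuous_on_snd continuous_on_id)
  have sub: "(\<lambda>z. (v(i := fst z), snd z)) ` (S \<times> {a..b}) \<subseteq> U \<times> {a..b}"
    by (auto simp: S_def)
  have "continuous_on (S \<times> {a..b}) (\<lambda>(x, t). g (v(i := x)) t)"
    using continuous_on_compose2[OF cont c sub] by (simp add: case_prod_unfold)
  then have "(\<lambda>x. integral {a..b} (g (v(i := x)))) holomorphic_on S"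
    using holomorphic_several_slice[OF hol i, of _ v]
    by (intro holomorphic_on_integral_param[OF S ab]) (simp_all add: S_def)
  then show "(\<lambda>t. integral {a..b} (g (v(i := t)))) field_differentiable at (v i)"
    using S v by (intro holomorphic_on_imp_differentiable_at[of _ S]) (simp_all add: S_def)
qed

text \<open>
  Holomorphy is a local property; the neighbourhoods are used below to choose a radius that is
  admissible for all fibres over the neighbourhood.
\<close>

lemma holomorphic_several_locally:
  assumes \<Omega>: "openin_cspace I \<Omega>"
    and loc: "\<And>v. v \<in> \<Omega> \<Longrightarrow> \<exists>U h. openin_cspace I U \<and> v \<in> U \<and> holomorphic_several I h U \<and> (\<forall>x\<in>U. h x = f x)"
  shows "holomorphic_several I f \<Omega>"
  unfolding holomorphic_several_def
proof (intro conjI ballI)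
  show "continuous_on \<Omega> f"
    unfolding continuous_on_eq_continuous_within
  proof
    fix v assume v: "v \<in> \<Omega>"
    obtain U h where U: "openin_cspace I U" "v \<in> U" "holomorphic_several I h U" "\<forall>x\<in>U. h x = f x"
      using loc[OF v] by blast
    obtain T where T: "open T" "U = cspace I \<inter> T" using U(1) by (auto simp: openin_open)
    have "continuous_on U h" using U(3) by (simp add: holomorphic_several_def)
    then have "continuous_on U f" using U(4) by (simp cong: continuous_on_cong)
    then have "continuous_on (\<Omega> \<inter> T) f"
      by (rule continuous_on_subset) (use openin_cspace_subset[OF \<Omega>] T in blast)
    then have "continuous (at v within \<Omega> \<inter> T) f"
      using v U(2) T by (auto simp: continuous_on_eq_continuous_within)
    moreover have "at v within \<Omega> \<inter> T = at v within \<Omega>"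
      using T U(2) by (intro at_within_nhd[where S = T]) auto
    ultimately show "continuous (at v within \<Omega>) f" by simp
  qed
next
  fix v i assume v: "v \<in> \<Omega>" and i: "i \<in> I"
  obtain U h where U: "openin_cspace I U" "v \<in> U" "holomorphic_several I h U" "\<forall>x\<in>U. h x = f x"
    using loc[OF v] by blast
  have o: "open {x. v(i := x) \<in> U}"
    using open_coordinate_slice[OF U(1) _ i] U(2) openin_cspace_subset[OF U(1)] by blast
  have "(\<lambda>x. f (v(i := x))) holomorphic_on {x. v(i := x) \<in> U}"
    by (rule holomorphic_transform[OF holomorphic_several_slice[OF U(3) i]]) (use U(4) in auto)
  then show "(\<lambda>t. f (v(i := t))) field_differentiable at (v i)"
    using o U(2) by (auto intro: holomorphic_on_imp_differentiable_at)
qed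

section \<open>Weighted Bergman spaces\<close>

lemma A2_I:
  assumes "holomorphic_several I f \<Omega>" "openin_cspace I \<Omega>" "continuous_on \<Omega> \<rho>" "\<forall>v\<in>\<Omega>. 0 \<le> \<rho> v"
    and "(\<integral>\<^sup>+v\<in>\<Omega>. ennreal ((norm (f v))\<^sup>2 * \<rho> v) \<partial>leb I) < \<infinity>"
  shows "f \<in> A2 I \<Omega> \<rho>"
proof -
  have "continuous_on \<Omega> (\<lambda>v. (norm (f v))\<^sup>2 * \<rho> v)"
    using assms by (intro continuous_intros) (simp_all add: holomorphic_several_def)
  from borel_measurable_leb_continuous[OF assms(2) this]
  have "set_integrable (leb I) \<Omega> (\<lambda>v. (norm (f v))\<^sup>2 * \<rho> v)"
    unfolding set_integrable_def
  proof (rule integrableI_bounded)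
    have "(\<integral>\<^sup>+v. ennreal (norm (indicator \<Omega> v *\<^sub>R ((norm (f v))\<^sup>2 * \<rho> v))) \<partial>leb I)
        = (\<integral>\<^sup>+v\<in>\<Omega>. ennreal ((norm (f v))\<^sup>2 * \<rho> v) \<partial>leb I)"
      by (intro nn_integral_cong) (auto simp: assms(4) split: split_indicator)
    then show "(\<integral>\<^sup>+v. ennreal (norm (indicator \<Omega> v *\<^sub>R ((norm (f v))\<^sup>2 * \<rho> v))) \<partial>leb I) < \<infinity>"
      using assms(5) by simp
  qed
  then show ?thesis using assms(1) by (simp add: A2_def)
qed

lemma A2_D:
  assumes "f \<in> A2 I \<Omega> \<rho>" "\<forall>v\<in>\<Omega>. 0 \<le> \<rho> v"
  shows "holomorphic_several I f \<Omega>" "continuous_on \<Omega> f"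
    and "(\<integral>\<^sup>+v\<in>\<Omega>. ennreal ((norm (f v))\<^sup>2 * \<rho> v) \<partial>leb I) < \<infinity>"
proof -
  show "holomorphic_several I f \<Omega>" "continuous_on \<Omega> f"
    using assms(1) by (simp_all add: A2_def holomorphic_several_def)
  have "integrable (leb I) (\<lambda>v. indicator \<Omega> v *\<^sub>R ((norm (f v))\<^sup>2 * \<rho> v))"
    using assms(1) by (simp add: A2_def set_integrable_def)
  then have "(\<integral>\<^sup>+v. ennreal (norm (indicator \<Omega> v *\<^sub>R ((norm (f v))\<^sup>2 * \<rho> v))) \<partial>leb I) < \<infinity>"
    by (simp add: integrable_iff_bounded)
  moreover have "(\<integral>\<^sup>+v. ennreal (norm (indicator \<Omega> v *\<^sub>R ((norm (f v))\<^sup>2 * \<rho> v))) \<partial>leb I)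
        = (\<integral>\<^sup>+v\<in>\<Omega>. ennreal ((norm (f v))\<^sup>2 * \<rho> v) \<partial>leb I)"
    by (intro nn_integral_cong) (auto simp: assms(2) split: split_indicator)
  ultimately show "(\<integral>\<^sup>+v\<in>\<Omega>. ennreal ((norm (f v))\<^sup>2 * \<rho> v) \<partial>leb I) < \<infinity>" by simp
qed

lemma A2_linear_combination:
  assumes \<Omega>: "openin_cspace I \<Omega>" and \<rho>: "continuous_on \<Omega> \<rho>" "\<forall>v\<in>\<Omega>. 0 \<le> \<rho> v"
    and f: "f \<in> A2 I \<Omega> \<rho>" and g: "g \<in> A2 I \<Omega> \<rho>"
  shows "(\<lambda>v. a * f v + b * g v) \<in> A2 I \<Omega> \<rho>"
proof -
  note F = A2_D[OF f \<rho>(2)] and G = A2_D[OF g \<rho>(2)]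
  have hol: "holomorphic_several I (\<lambda>v. a * f v + b * g v) \<Omega>"
    using F(1) G(1) unfolding holomorphic_several_def
    by (auto intro!: continuous_intros field_differentiable_add field_differentiable_mult
        field_differentiable_const)
  have "set_integrable (leb I) \<Omega> (\<lambda>v. (norm (a * f v + b * g v))\<^sup>2 * \<rho> v)"
  proof (rule set_integrable_bound)
    show "set_integrable (leb I) \<Omega> (\<lambda>v. 2 * (norm a)\<^sup>2 * ((norm (f v))\<^sup>2 * \<rho> v) + 2 * (norm b)\<^sup>2 * ((norm (g v))\<^sup>2 * \<rho> v))"
      using f g by (intro set_integral_add set_integrable_mult_right) (simp_all add: A2_def)
    have "continuous_on \<Omega> (\<lambda>v. (norm (a * f v + b * g v))\<^sup>2 * \<rho> v)"
      by (intro continuous_intros F(2) G(2) \<rho>(1))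
    then show "set_borel_measurable (leb I) \<Omega> (\<lambda>v. (norm (a * f v + b * g v))\<^sup>2 * \<rho> v)"
      unfolding set_borel_measurable_def by (rule borel_measurable_leb_continuous[OF \<Omega>])
    show "AE v in leb I. v \<in> \<Omega> \<longrightarrow> norm ((norm (a * f v + b * g v))\<^sup>2 * \<rho> v)
        \<le> norm (2 * (norm a)\<^sup>2 * ((norm (f v))\<^sup>2 * \<rho> v) + 2 * (norm b)\<^sup>2 * ((norm (g v))\<^sup>2 * \<rho> v))"
    proof (intro AE_I2 impI)
      fix v assume v: "v \<in> \<Omega>"
      have "(norm (a * f v + b * g v))\<^sup>2 \<le> (norm a * norm (f v) + norm b * norm (g v))\<^sup>2"
        using norm_triangle_ineq[of "a * f v" "b * g v"] by (intro power_mono) (simp_all add: norm_mult)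
      also have "\<dots> \<le> 2 * (norm a * norm (f v))\<^sup>2 + 2 * (norm b * norm (g v))\<^sup>2"
        using sum_squares_bound[of "norm a * norm (f v)" "norm b * norm (g v)"]
        unfolding power2_sum by linarith
      finally have "(norm (a * f v + b * g v))\<^sup>2 * \<rho> v
          \<le> (2 * (norm a * norm (f v))\<^sup>2 + 2 * (norm b * norm (g v))\<^sup>2) * \<rho> v"
        using bspec[OF \<rho>(2) v] by (intro mult_right_mono)
      also have "\<dots> = 2 * (norm a)\<^sup>2 * ((norm (f v))\<^sup>2 * \<rho> v) + 2 * (norm b)\<^sup>2 * ((norm (g v))\<^sup>2 * \<rho> v)"
        by (simp add: power_mult_distrib algebra_simps)
      finally show "norm ((norm (a * f v + b * g v))\<^sup>2 * \<rho> v)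
        \<le> norm (2 * (norm a)\<^sup>2 * ((norm (f v))\<^sup>2 * \<rho> v) + 2 * (norm b)\<^sup>2 * ((norm (g v))\<^sup>2 * \<rho> v))"
        using bspec[OF \<rho>(2) v] by simp
    qed
  qed
  then show ?thesis using hol by (simp add: A2_def)
qed

lemma A2_integrable_inner:
  assumes \<Omega>: "openin_cspace I \<Omega>" and \<rho>: "continuous_on \<Omega> \<rho>" "\<forall>v\<in>\<Omega>. 0 \<le> \<rho> v"
    and f: "f \<in> A2 I \<Omega> \<rho>" and g: "g \<in> A2 I \<Omega> \<rho>"
  shows "set_integrable (leb I) \<Omega> (\<lambda>v. f v * cnj (g v) * complex_of_real (\<rho> v))"
proof (rule set_integrable_bound)
  note F = A2_D[OF f \<rho>(2)] and G = A2_D[OF g \<rho>(2)]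
  show "set_integrable (leb I) \<Omega> (\<lambda>v. (norm (f v))\<^sup>2 * \<rho> v + (norm (g v))\<^sup>2 * \<rho> v)"
    using f g by (intro set_integral_add) (simp_all add: A2_def)
  have "continuous_on \<Omega> (\<lambda>v. f v * cnj (g v) * complex_of_real (\<rho> v))"
    by (intro continuous_intros F(2) G(2) \<rho>(1))
  then show "set_borel_measurable (leb I) \<Omega> (\<lambda>v. f v * cnj (g v) * complex_of_real (\<rho> v))"
    unfolding set_borel_measurable_def by (rule borel_measurable_leb_continuous[OF \<Omega>])
  show "AE v in leb I. v \<in> \<Omega> \<longrightarrow> norm (f v * cnj (g v) * complex_of_real (\<rho> v))
        \<le> norm ((norm (f v))\<^sup>2 * \<rho> v + (norm (g v))\<^sup>2 * \<rho> v)"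
  proof (intro AE_I2 impI)
    fix v assume v: "v \<in> \<Omega>"
    have "2 * norm (f v) * norm (g v) \<le> (norm (f v))\<^sup>2 + (norm (g v))\<^sup>2"
      by (rule sum_squares_bound)
    then have "norm (f v) * norm (g v) \<le> (norm (f v))\<^sup>2 + (norm (g v))\<^sup>2"
      using mult_nonneg_nonneg[of "norm (f v)" "norm (g v)"] by (simp del: mult_nonneg_nonneg)
    then have "norm (f v) * norm (g v) * \<rho> v \<le> ((norm (f v))\<^sup>2 + (norm (g v))\<^sup>2) * \<rho> v"
      using bspec[OF \<rho>(2) v] by (intro mult_right_mono)
    then show "norm (f v * cnj (g v) * complex_of_real (\<rho> v))
        \<le> norm ((norm (f v))\<^sup>2 * \<rho> v + (norm (g v))\<^sup>2 * \<rho> v)"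
      using bspec[OF \<rho>(2) v] by (simp add: norm_mult distrib_right)
  qed
qed

text \<open>
  The difference of two representers is orthogonal to the whole space, in particular to itself, so
  it vanishes almost everywhere; being continuous, it vanishes everywhere, because nonempty open
  sets have positive measure.
\<close>

lemma A2_representer_unique:
  assumes I: "finite I" and \<Omega>: "openin_cspace I \<Omega>"
    and \<rho>: "continuous_on \<Omega> \<rho>" "\<forall>v\<in>\<Omega>. 0 < \<rho> v"
    and g: "g1 \<in> A2 I \<Omega> \<rho>" "g2 \<in> A2 I \<Omega> \<rho>"
    and eq: "\<And>f. f \<in> A2 I \<Omega> \<rho> \<Longrightarrow>
      (LINT v:\<Omega>|leb I. f v * cnj (g1 v) * complex_of_real (\<rho> v))
      = (LINT v:\<Omega>|leb I. f v * cnj (g2 v) * complex_of_real (\<rho> v))"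
    and v: "v \<in> \<Omega>"
  shows "g1 v = g2 v"
proof (rule ccontr)
  assume ne: "g1 v \<noteq> g2 v"
  have \<rho>0: "\<forall>v\<in>\<Omega>. 0 \<le> \<rho> v" using \<rho>(2) by (auto intro: less_imp_le)
  define d where "d = (\<lambda>v. g1 v - g2 v)"
  have d: "d \<in> A2 I \<Omega> \<rho>"
    using A2_linear_combination[OF \<Omega> \<rho>(1) \<rho>0 g, of 1 "-1"] by (simp add: d_def)
  note int = A2_integrable_inner[OF \<Omega> \<rho>(1) \<rho>0 d]
  have "(LINT v:\<Omega>|leb I. complex_of_real ((norm (d v))\<^sup>2 * \<rho> v))
      = (LINT v:\<Omega>|leb I. d v * cnj (g1 v) * complex_of_real (\<rho> v) - d v * cnj (g2 v) * complex_of_real (\<rho> v))"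
  proof -
    have "complex_of_real ((norm (d v))\<^sup>2 * \<rho> v)
      = d v * cnj (g1 v) * complex_of_real (\<rho> v) - d v * cnj (g2 v) * complex_of_real (\<rho> v)" for v
      unfolding of_real_mult complex_norm_square by (simp add: d_def algebra_simps)
    then show ?thesis by simp
  qed
  also have "\<dots> = 0"
    by (subst set_integral_diff(2)[OF int[OF g(1)] int[OF g(2)]]) (simp add: eq[OF d])
  finally have "complex_of_real (LINT v:\<Omega>|leb I. (norm (d v))\<^sup>2 * \<rho> v) = 0"
    by (simp only: set_integral_complex_of_real)
  then have zero: "(LINT v|leb I. indicator \<Omega> v *\<^sub>R ((norm (d v))\<^sup>2 * \<rho> v)) = 0"
    by (simp add: set_lebesgue_integral_def)
  have "integrable (leb I) (\<lambda>v. indicator \<Omega> v *\<^sub>R ((norm (d v))\<^sup>2 * \<rho> v))"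
    using d by (simp add: A2_def set_integrable_def)
  from integral_nonneg_eq_0_iff_AE[OF this] zero
  have AE0: "AE v in leb I. indicator \<Omega> v *\<^sub>R ((norm (d v))\<^sup>2 * \<rho> v) = 0"
    using \<rho>0 by (auto simp: indicator_def)
  define U where "U = \<Omega> \<inter> d -` (- {0})"
  have "openin (top_of_set \<Omega>) U" unfolding U_def
    by (rule continuous_openin_preimage_gen[OF A2_D(2)[OF d \<rho>0]]) auto
  then have U: "openin_cspace I U" using \<Omega> by (rule openin_trans)
  have "AE v in leb I. v \<notin> U"
    using AE0 by eventually_elim (use \<rho>(2) in \<open>force simp: U_def indicator_def\<close>)
  then have "emeasure (leb I) U = 0"
    using sets_leb_openin[OF U] openin_cspace_subset[OF U]
    by (subst (asm) AE_iff_measurable[where N = U]) (auto simp: space_leb)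
  moreover have "v \<in> U" using v ne by (simp add: U_def d_def)
  ultimately show False using emeasure_leb_pos[OF I U] by auto
qed

section \<open>The ellipsoid as a family of discs over the ball\<close>

lemma cpair_in_cspace: "w \<in> cspace {1..n} \<Longrightarrow> cpair z w \<in> cspace {0..n}"
  by (auto simp: mem_cspace_iff cpair_def)

lemma cspace_split:
  assumes "\<zeta> \<in> cspace {0..n}"
  shows "\<zeta>(0 := undefined) \<in> cspace {1..n}" and "cpair (\<zeta> 0) (\<zeta>(0 := undefined)) = \<zeta>"
  using assms by (auto simp: mem_cspace_iff cpair_def)

lemma cpair_project:
  assumes "w \<in> cspace {1..n}"
  shows "(cpair z w)(0 := undefined) = w" and "cpair z w 0 = z"
  using assms by (auto simp: mem_cspace_iff cpair_def)

lemma cpair_in_ellipsoid_iff: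
  assumes "w \<in> cspace {1..n}"
  shows "cpair z w \<in> ellipsoid_dom n p \<longleftrightarrow> (norm z)\<^sup>2 + p w < 1"
proof
  assume "cpair z w \<in> ellipsoid_dom n p"
  then obtain z' w' where *: "cpair z w = cpair z' w'" "w' \<in> cspace {1..n}" "(norm z')\<^sup>2 + p w' < 1"
    by (auto simp: ellipsoid_dom_def)
  then have "z = z'" "w = w'"
    using cpair_project[OF assms, of z] cpair_project[OF *(2), of z'] by metis+
  with * show "(norm z)\<^sup>2 + p w < 1" by simp
qed (use assms in \<open>auto simp: ellipsoid_dom_def\<close>)

lemma ellipsoid_dom_eq:
  "ellipsoid_dom n p = {\<zeta> \<in> cspace {0..n}. (norm (\<zeta> 0))\<^sup>2 + p (\<zeta>(0 := undefined)) < 1}"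
proof (intro equalityI subsetI)
  fix \<zeta> assume "\<zeta> \<in> ellipsoid_dom n p"
  then obtain z w where "\<zeta> = cpair z w" "w \<in> cspace {1..n}" "(norm z)\<^sup>2 + p w < 1"
    by (auto simp: ellipsoid_dom_def)
  then show "\<zeta> \<in> {\<zeta> \<in> cspace {0..n}. (norm (\<zeta> 0))\<^sup>2 + p (\<zeta>(0 := undefined)) < 1}"
    using cpair_in_cspace cpair_project by auto
next
  fix \<zeta> assume \<zeta>: "\<zeta> \<in> {\<zeta> \<in> cspace {0..n}. (norm (\<zeta> 0))\<^sup>2 + p (\<zeta>(0 := undefined)) < 1}"
  then have "\<zeta> \<in> cspace {0..n}" by simp
  from cpair_in_ellipsoid_iff[OF cspace_split(1)[OF this], of "\<zeta> 0" p] cspace_split(2)[OF this] \<zeta>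
  show "\<zeta> \<in> ellipsoid_dom n p" by simp
qed

text \<open>
  The fibre of the ellipsoid over \<open>v\<close> is the disc of radius \<open>sqrt (1 - p v)\<close>, and it is empty unless
  \<open>v\<close> lies in the ball. With Fubini this reduces integrals over the ellipsoid to the disc lemmas.
\<close>

lemma slice_iff:
  assumes "v \<in> cspace {1..n}"
  shows "cpair t v \<in> ellipsoid_dom n p \<longleftrightarrow> v \<in> ball_dom n p \<and> t \<in> ball 0 (sqrt (1 - p v))"
proof -
  have "(norm t)\<^sup>2 + p v < 1 \<longleftrightarrow> norm t < sqrt (1 - p v)"
    by (smt (verit) norm_ge_zero real_less_rsqrt real_sqrt_abs real_sqrt_less_iff abs_of_nonneg)
  moreover have "p v < 1" if "(norm t)\<^sup>2 + p v < 1"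
    using that by (smt (verit) zero_le_power2)
  ultimately show ?thesis
    unfolding cpair_in_ellipsoid_iff[OF assms] using assms by (auto simp: ball_dom_def)
qed

lemma openin_ball_dom:
  assumes "continuous_on (cspace {1..n}) p"
  shows "openin_cspace {1..n} (ball_dom n p)"
proof -
  have "ball_dom n p = cspace {1..n} \<inter> p -` {..<1}" by (auto simp: ball_dom_def)
  then show ?thesis using assms by (simp add: continuous_openin_preimage_gen)
qed

lemma continuous_on_drop_first:
  "continuous_on A (\<lambda>\<zeta> :: point. \<zeta>(0 := undefined))"
  by (intro continuous_on_fun_upd continuous_on_id continuous_on_const)

lemma openin_ellipsoid_dom:
  assumes p: "continuous_on (cspace {1..n}) p"
  shows "openin_cspace {0..n} (ellipsoid_dom n p)"
proof -
  let ?q = "\<lambda>\<zeta> :: point. (norm (\<zeta> 0))\<^sup>2 + p (\<zeta>(0 := undefined))"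
  have "continuous_on (cspace {0..n}) (\<lambda>\<zeta>. p (\<zeta>(0 := undefined)))"
    by (rule continuous_on_compose2[OF p continuous_on_drop_first]) (use cspace_split in auto)
  moreover have "continuous_on (cspace {0..n}) (\<lambda>\<zeta> :: point. \<zeta> 0)"
    by (rule continuous_on_subset[OF continuous_on_product_coordinates subset_UNIV])
  ultimately have "continuous_on (cspace {0..n}) ?q" by (intro continuous_intros)
  moreover have "ellipsoid_dom n p = cspace {0..n} \<inter> ?q -` {..<1}"
    by (auto simp: ellipsoid_dom_eq)
  ultimately show ?thesis by (simp add: continuous_openin_preimage_gen)
qed

lemma weighted_homogeneous_continuous:
  assumes "weighted_homogeneous_balanced n m p"
  shows "continuous_on (cspace {1..n}) p"
proof -
  obtain C :: "(nat \<Rightarrow> nat) \<Rightarrow> (nat \<Rightarrow> nat) \<Rightarrow> complex" where C: "\<forall>w\<in>cspace {1..n}.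
        complex_of_real (p w) =
          (\<Sum>\<alpha>\<in>half_weight_indices n m. \<Sum>\<beta>\<in>half_weight_indices n m.
             C \<alpha> \<beta> * (\<Prod>i=1..n. w i ^ \<alpha> i) * (\<Prod>i=1..n. cnj (w i) ^ \<beta> i))"
    using assms unfolding weighted_homogeneous_balanced_def ..
  define P :: "point \<Rightarrow> complex" where
    "P w = (\<Sum>\<alpha>\<in>half_weight_indices n m. \<Sum>\<beta>\<in>half_weight_indices n m.
             C \<alpha> \<beta> * (\<Prod>i=1..n. w i ^ \<alpha> i) * (\<Prod>i=1..n. cnj (w i) ^ \<beta> i))" for w
  have coord: "continuous_on (cspace {1..n}) (\<lambda>w :: point. w i)" for i
    by (rule continuous_on_subset[OF continuous_on_product_coordinates subset_UNIV])
  have "continuous_on (cspace {1..n}) (\<lambda>w. Re (P w))"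
    unfolding P_def by (intro continuous_intros coord)
  moreover have "p w = Re (P w)" if "w \<in> cspace {1..n}" for w
    using C that by (metis P_def Re_complex_of_real)
  ultimately show ?thesis by (simp cong: continuous_on_cong)
qed

lemma insert_zero_interval: "{0..n} = insert 0 {1..n :: nat}" by auto

lemma nn_integral_leb_cpair:
  assumes "f \<in> borel_measurable (leb {0..n})"
  shows "(\<integral>\<^sup>+\<zeta>. f \<zeta> \<partial>leb {0..n}) = (\<integral>\<^sup>+v. (\<integral>\<^sup>+t. f (cpair t v) \<partial>lborel) \<partial>leb {1..n})"
proof -
  interpret product_sigma_finite "\<lambda>_::nat. lborel :: complex measure"
    by (rule product_sigma_finite_lborel)
  show ?thesis using assms unfolding leb_def insert_zero_interval cpair_def
    by (intro product_nn_integral_insert) auto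
qed

lemma integral_leb_cpair:
  fixes f :: "point \<Rightarrow> complex"
  assumes "integrable (leb {0..n}) f"
  shows "(LINT \<zeta>|leb {0..n}. f \<zeta>) = (LINT v|leb {1..n}. (LINT t|lborel. f (cpair t v)))"
proof -
  interpret product_sigma_finite "\<lambda>_::nat. lborel :: complex measure"
    by (rule product_sigma_finite_lborel)
  show ?thesis using assms unfolding leb_def insert_zero_interval cpair_def
    by (intro product_integral_insert) auto
qed

lemma measurable_cpair_slices:
  fixes f :: "point \<Rightarrow> ennreal"
  assumes "f \<in> borel_measurable (leb {0..n})"
  shows "(\<lambda>v. \<integral>\<^sup>+t. f (cpair t v) \<partial>lborel) \<in> borel_measurable (leb {1..n})"
proof -
  have "(\<lambda>(v, t). cpair t v) \<in> (leb {1..n} \<Otimes>\<^sub>M lborel) \<rightarrow>\<^sub>M leb {0..n}"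
    unfolding leb_def insert_zero_interval cpair_def by measurable
  from measurable_compose[OF this assms] show ?thesis
    by (intro lborel.borel_measurable_nn_integral) (simp add: case_prod_unfold)
qed

lemma slice_holomorphic:
  assumes b: "holomorphic_several {0..n} b (ellipsoid_dom n p)" and v: "v \<in> ball_dom n p"
  shows "(\<lambda>t. b (cpair t v)) holomorphic_on ball 0 (sqrt (1 - p v))"
proof -
  have vc: "v \<in> cspace {1..n}" using v by (simp add: ball_dom_def)
  have "(\<lambda>t. b (v(0 := t))) holomorphic_on {t. v(0 := t) \<in> ellipsoid_dom n p}"
    by (rule holomorphic_several_slice[OF b]) simp
  moreover have "{t. v(0 := t) \<in> ellipsoid_dom n p} = ball 0 (sqrt (1 - p v))"
  proof -
    have "v(0 := t) \<in> ellipsoid_dom n p \<longleftrightarrow> t \<in> ball 0 (sqrt (1 - p v))" for t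
      using slice_iff[OF vc, of t p] v unfolding cpair_def by blast
    then show ?thesis by blast
  qed
  ultimately show ?thesis by (simp add: cpair_def)
qed

section \<open>Taylor coefficients along the fibres\<close>

definition fibre_coeff :: "(point \<Rightarrow> complex) \<Rightarrow> nat \<Rightarrow> point \<Rightarrow> complex" where
  "fibre_coeff b k v = taylor_coeff (\<lambda>t. b (cpair t v)) k"

text \<open>
  Near a given point all fibres contain a common circle about the origin. On that neighbourhood the
  coefficient is a mean over the circle, hence a parameter integral of holomorphic functions.
\<close>

lemma fibre_coeff_holomorphic:
  assumes p: "continuous_on (cspace {1..n}) p"
    and b: "holomorphic_several {0..n} b (ellipsoid_dom n p)"
  shows "holomorphic_several {1..n} (fibre_coeff b k) (ball_dom n p)"
proof (rule holomorphic_several_locally[OF openin_ball_dom[OF p]])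
  fix v0 assume v0: "v0 \<in> ball_dom n p"
  \<comment> \<open>Half of the squared radius at the centre leaves room for the fibres nearby.\<close>
  define r where "r = sqrt ((1 - p v0) / 2)"
  have r: "r > 0" "r\<^sup>2 = (1 - p v0) / 2" using v0 by (simp_all add: r_def ball_dom_def)
  define U where "U = cspace {1..n} \<inter> p -` {..<1 - r\<^sup>2}"
  have U: "openin_cspace {1..n} U" unfolding U_def
    by (intro continuous_openin_preimage_gen p) simp
  have v0U: "v0 \<in> U" using v0 r by (simp add: U_def ball_dom_def field_simps)
  have UD: "v \<in> ball_dom n p" "v \<in> cspace {1..n}" if "v \<in> U" for v
    using that r(1) by (auto simp: U_def ball_dom_def intro: less_trans)
  have inE: "cpair (cis t * of_real r) v \<in> ellipsoid_dom n p" if "v \<in> U" for t v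
    using that r(1) UD[OF that]
    by (subst cpair_in_ellipsoid_iff) (auto simp: U_def norm_mult)
  define g where "g v t = b (cpair (cis t * of_real r) v) * cnj (cis t) ^ k / of_real (2 * pi * r ^ k)" for v t
  have coeff: "integral {0..2*pi} (g v) = fibre_coeff b k v" if v: "v \<in> U" for v
  proof -
    have "norm (of_real r :: complex) < sqrt (1 - p v)"
      using inE[OF v, of 0] slice_iff[OF UD(2)[OF v], of "of_real r" p] by simp
    from circle_average_taylor_coeff(1)[OF slice_holomorphic[OF b UD(1)[OF v]] this, of k]
    have "(g v has_integral of_real (2 * pi) * fibre_coeff b k v * of_real r ^ k / of_real (2 * pi * r ^ k)) {0..2*pi}"
      unfolding g_def fibre_coeff_def by (rule has_integral_divide)
    then show ?thesis using r(1) by (simp add: integral_unique)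
  qed
  have contb: "continuous_on (ellipsoid_dom n p) b" using b by (simp add: holomorphic_several_def)
  have "holomorphic_several {1..n} (\<lambda>v. integral {0..2*pi} (g v)) U"
  proof (rule holomorphic_several_integral_param[OF U])
    have "continuous_on (U \<times> {0..2*pi}) (\<lambda>z. cpair (cis (snd z) * of_real r) (fst z))"
      unfolding cpair_def by (intro continuous_on_fun_upd continuous_intros)
    then have "continuous_on (U \<times> {0..2*pi}) (\<lambda>z. b (cpair (cis (snd z) * of_real r) (fst z)))"
      by (rule continuous_on_compose2[OF contb]) (use inE in auto)
    then show "continuous_on (U \<times> {0..2*pi}) (\<lambda>(v, t). g v t)"
      unfolding g_def case_prod_unfold using r(1) by (intro continuous_intros) simp_all
  next
    fix t :: real
    define c where "c = cis t * complex_of_real r"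
    have "holomorphic_several {1..n} (\<lambda>v. b (cpair c v)) U"
      unfolding holomorphic_several_def
    proof (intro conjI ballI)
      show "continuous_on U (\<lambda>v. b (cpair c v))"
        by (rule continuous_on_compose2[OF contb])
          (use inE in \<open>auto simp: c_def cpair_def intro!: continuous_on_fun_upd continuous_on_id continuous_on_const\<close>)
      fix v i assume v: "v \<in> U" and i: "i \<in> {1..n}"
      have "cpair c v \<in> ellipsoid_dom n p" unfolding c_def by (rule inE[OF v])
      moreover have "i \<in> {0..n}" using i by simp
      ultimately have "(\<lambda>x. b ((cpair c v)(i := x))) field_differentiable at (cpair c v i)"
        using b unfolding holomorphic_several_def by blast
      moreover have "cpair c v i = v i" "(cpair c v)(i := x) = cpair c (v(i := x))" for x
        using i by (auto simp: cpair_def)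
      ultimately show "(\<lambda>x. b (cpair c (v(i := x)))) field_differentiable at (v i)" by simp
    qed
    then show "holomorphic_several {1..n} (\<lambda>v. g v t) U"
      unfolding g_def c_def[symmetric] times_divide_eq_right[symmetric]
      by (rule holomorphic_several_mult_const)
  qed simp
  then show "\<exists>U h. openin_cspace {1..n} U \<and> v0 \<in> U \<and> holomorphic_several {1..n} h U \<and> (\<forall>x\<in>U. h x = fibre_coeff b k x)"
    using U v0U coeff by blast
qed

lemma continuous_on_weight:
  assumes "continuous_on (cspace {1..n}) p"
  shows "continuous_on (ball_dom n p) (\<lambda>u. (1 - p u) ^ (k + 1))"
  by (intro continuous_intros continuous_on_subset[OF assms]) (auto simp: ball_dom_def)

lemma weight_pos: "\<forall>u\<in>ball_dom n p. 0 < (1 - p u) ^ (k + 1)"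
  by (auto simp: ball_dom_def)

lemma weight_nonneg: "\<forall>u\<in>ball_dom n p. 0 \<le> (1 - p u) ^ (k + 1)"
  by (simp add: ball_dom_def)

text \<open>
  Tonelli for the squared modulus of an element of the Bergman space of the ellipsoid: \<open>N v\<close> is the
  squared norm of its restriction to the fibre over \<open>v\<close>, which is therefore finite for almost every
  \<open>v\<close>.
\<close>

lemma A2_ellipsoid_slices:
  assumes p: "continuous_on (cspace {1..n}) p" and b: "b \<in> A2 {0..n} (ellipsoid_dom n p) (\<lambda>_. 1)"
  defines "N \<equiv> \<lambda>v. \<integral>\<^sup>+t. ennreal ((norm (b (cpair t v)))\<^sup>2) * indicator (ellipsoid_dom n p) (cpair t v) \<partial>lborel"
  shows "N \<in> borel_measurable (leb {1..n})" and "(\<integral>\<^sup>+v. N v \<partial>leb {1..n}) < \<infinity>"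
    and "\<And>v. v \<in> ball_dom n p \<Longrightarrow>
      N v = (\<integral>\<^sup>+t\<in>ball 0 (sqrt (1 - p v)). ennreal ((norm (b (cpair t v)))\<^sup>2) \<partial>lborel)"
proof -
  have B: "continuous_on (ellipsoid_dom n p) b"
    "(\<integral>\<^sup>+\<zeta>\<in>ellipsoid_dom n p. ennreal ((norm (b \<zeta>))\<^sup>2 * 1) \<partial>leb {0..n}) < \<infinity>"
    using A2_D(2,3)[OF b] by simp_all
  have c2: "continuous_on (ellipsoid_dom n p) (\<lambda>\<zeta>. (norm (b \<zeta>))\<^sup>2)"
    by (intro continuous_intros B(1))
  have m: "(\<lambda>\<zeta>. ennreal ((norm (b \<zeta>))\<^sup>2) * indicator (ellipsoid_dom n p) \<zeta>) \<in> borel_measurable (leb {0..n})"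
    by (rule borel_measurable_leb_continuous_ennreal[OF openin_ellipsoid_dom[OF p] c2])
  show "N \<in> borel_measurable (leb {1..n})"
    unfolding N_def by (rule measurable_cpair_slices[OF m])
  show "(\<integral>\<^sup>+v. N v \<partial>leb {1..n}) < \<infinity>"
    unfolding N_def nn_integral_leb_cpair[OF m, symmetric] using B(2) by simp
  show "N v = (\<integral>\<^sup>+t\<in>ball 0 (sqrt (1 - p v)). ennreal ((norm (b (cpair t v)))\<^sup>2) \<partial>lborel)"
    if "v \<in> ball_dom n p" for v
  proof -
    have "v \<in> cspace {1..n}" using that by (simp add: ball_dom_def)
    then have "indicator (ellipsoid_dom n p) (cpair t v) = (indicator (ball 0 (sqrt (1 - p v))) t :: ennreal)" for t
      using slice_iff[of v n t p] that by (simp add: indicator_def)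
    then show ?thesis unfolding N_def by simp
  qed
qed

text \<open>
  Integrating Bessel's inequality on the fibres over the ball bounds the weighted norm of the
  coefficient by the norm of \<open>b\<close>.
\<close>

lemma fibre_coeff_A2:
  assumes p: "continuous_on (cspace {1..n}) p" and b: "b \<in> A2 {0..n} (ellipsoid_dom n p) (\<lambda>_. 1)"
  shows "fibre_coeff b k \<in> A2 {1..n} (ball_dom n p) (\<lambda>u. (1 - p u) ^ (k + 1))"
proof (rule A2_I[OF _ openin_ball_dom[OF p] continuous_on_weight[OF p] weight_nonneg])
  have bh: "holomorphic_several {0..n} b (ellipsoid_dom n p)" using b by (simp add: A2_def)
  then show "holomorphic_several {1..n} (fibre_coeff b k) (ball_dom n p)"
    by (rule fibre_coeff_holomorphic[OF p])
  note S = A2_ellipsoid_slices[OF p b]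
  let ?N = "\<lambda>v. \<integral>\<^sup>+t. ennreal ((norm (b (cpair t v)))\<^sup>2) * indicator (ellipsoid_dom n p) (cpair t v) \<partial>lborel"
  let ?c = "ennreal ((real k + 1) / pi)"
  have "(\<integral>\<^sup>+v\<in>ball_dom n p. ennreal ((norm (fibre_coeff b k v))\<^sup>2 * (1 - p v) ^ (k + 1)) \<partial>leb {1..n})
      \<le> (\<integral>\<^sup>+v. ?c * ?N v \<partial>leb {1..n})"
  proof (rule nn_integral_mono)
    fix v
    show "ennreal ((norm (fibre_coeff b k v))\<^sup>2 * (1 - p v) ^ (k + 1)) * indicator (ball_dom n p) v \<le> ?c * ?N v"
    proof (cases "v \<in> ball_dom n p")
      case True
      then have pv: "p v < 1" by (simp add: ball_dom_def)
      have "ennreal ((norm (fibre_coeff b k v))\<^sup>2 * (pi * (1 - p v) ^ (k + 1) / (real k + 1))) \<le> ?N v"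
        using disc_bessel[OF slice_holomorphic[OF bh True], of k] pv
        unfolding S(3)[OF True] fibre_coeff_def by simp
      then have "?c * ennreal ((norm (fibre_coeff b k v))\<^sup>2 * (pi * (1 - p v) ^ (k + 1) / (real k + 1))) \<le> ?c * ?N v"
        by (rule mult_left_mono) simp
      moreover have "?c * ennreal ((norm (fibre_coeff b k v))\<^sup>2 * (pi * (1 - p v) ^ (k + 1) / (real k + 1)))
          = ennreal ((norm (fibre_coeff b k v))\<^sup>2 * (1 - p v) ^ (k + 1))"
      proof -
        have cancel: "K / pi * (X * (pi * Y / K)) = X * Y" if "K \<noteq> 0" for K X Y :: real
          using that by simp
        show ?thesis
          using pv by (subst ennreal_mult[symmetric]) (simp_all only: cancel, simp_all)
      qed
      ultimately show ?thesis using True by simp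
    qed simp
  qed
  also have "\<dots> = ?c * (\<integral>\<^sup>+v. ?N v \<partial>leb {1..n})"
    by (rule nn_integral_cmult[OF S(1)])
  also have "\<dots> < \<infinity>" using S(2) by (simp add: ennreal_mult_less_top)
  finally show "(\<integral>\<^sup>+v\<in>ball_dom n p. ennreal ((norm (fibre_coeff b k v))\<^sup>2 * (1 - p v) ^ (k + 1)) \<partial>leb {1..n}) < \<infinity>" .
qed

text \<open>
  The function \<open>(t, v) \<mapsto> f(v) t\<^sup>k\<close>. Its first coordinate is reset to \<open>undefined\<close> before \<open>f\<close> is
  applied because this is the value that points of \<open>cspace {1..n}\<close> have at index \<open>0\<close>.
\<close>

definition fibre_monomial :: "(point \<Rightarrow> complex) \<Rightarrow> nat \<Rightarrow> point \<Rightarrow> complex" where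
  "fibre_monomial f k \<zeta> = f (\<zeta>(0 := undefined)) * \<zeta> 0 ^ k"

lemma fibre_monomial_A2:
  assumes p: "continuous_on (cspace {1..n}) p"
    and f: "f \<in> A2 {1..n} (ball_dom n p) (\<lambda>u. (1 - p u) ^ (k + 1))"
  shows "fibre_monomial f k \<in> A2 {0..n} (ellipsoid_dom n p) (\<lambda>_. 1)"
proof (rule A2_I[OF _ openin_ellipsoid_dom[OF p]])
  note F = A2_D[OF f weight_nonneg]
  have drop: "\<zeta>(0 := undefined) \<in> ball_dom n p" if "\<zeta> \<in> ellipsoid_dom n p" for \<zeta>
    using that slice_iff[OF cspace_split(1), of \<zeta> n "\<zeta> 0" p] cspace_split(2)[of \<zeta> n]
    by (auto simp: ellipsoid_dom_eq)
  have coord: "continuous_on (ellipsoid_dom n p) (\<lambda>\<zeta> :: point. \<zeta> 0)"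
    by (rule continuous_on_subset[OF continuous_on_product_coordinates subset_UNIV])
  have contF: "continuous_on (ellipsoid_dom n p) (fibre_monomial f k)"
    unfolding fibre_monomial_def
    by (intro continuous_intros coord continuous_on_compose2[OF F(2) continuous_on_drop_first])
      (use drop in auto)
  show "holomorphic_several {0..n} (fibre_monomial f k) (ellipsoid_dom n p)"
    unfolding holomorphic_several_def
  proof (intro conjI ballI contF)
    fix \<zeta> i assume \<zeta>: "\<zeta> \<in> ellipsoid_dom n p" and i: "i \<in> {0..n}"
    show "(\<lambda>t. fibre_monomial f k (\<zeta>(i := t))) field_differentiable at (\<zeta> i)"
    proof (cases "i = 0")
      case True
      have "(\<lambda>t. f (\<zeta>(0 := undefined)) * t ^ k) field_differentiable at (\<zeta> 0)"
        by (intro derivative_intros)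
      then show ?thesis using True by (simp add: fibre_monomial_def)
    next
      case False
      have "(\<lambda>t. f ((\<zeta>(0 := undefined))(i := t))) field_differentiable at ((\<zeta>(0 := undefined)) i)"
        using F(1) drop[OF \<zeta>] i False unfolding holomorphic_several_def by auto
      then have "(\<lambda>t. f ((\<zeta>(0 := undefined))(i := t)) * \<zeta> 0 ^ k) field_differentiable at (\<zeta> i)"
        using False by (intro field_differentiable_mult field_differentiable_const) simp
      then show ?thesis using False by (simp add: fibre_monomial_def fun_upd_twist)
    qed
  qed
  let ?G = "\<lambda>\<zeta>. ennreal ((norm (fibre_monomial f k \<zeta>))\<^sup>2 * 1) * indicator (ellipsoid_dom n p) \<zeta>"
  have "continuous_on (ellipsoid_dom n p) (\<lambda>\<zeta>. (norm (fibre_monomial f k \<zeta>))\<^sup>2 * 1)"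
    by (intro continuous_intros contF)
  then have m: "?G \<in> borel_measurable (leb {0..n})"
    by (rule borel_measurable_leb_continuous_ennreal[OF openin_ellipsoid_dom[OF p]])
  have "(\<integral>\<^sup>+\<zeta>. ?G \<zeta> \<partial>leb {0..n}) = (\<integral>\<^sup>+v. (\<integral>\<^sup>+t. ?G (cpair t v) \<partial>lborel) \<partial>leb {1..n})"
    by (rule nn_integral_leb_cpair[OF m])
  also have "\<dots> = (\<integral>\<^sup>+v. ennreal (pi / (real k + 1)) *
      (ennreal ((norm (f v))\<^sup>2 * (1 - p v) ^ (k + 1)) * indicator (ball_dom n p) v) \<partial>leb {1..n})"
  proof (rule nn_integral_cong)
    fix v assume "v \<in> space (leb {1..n})"
    then have v: "v \<in> cspace {1..n}" by (simp add: space_leb)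
    have G: "?G (cpair t v) = ennreal ((norm (f v))\<^sup>2) * indicator (ball_dom n p) v
        * (ennreal (norm t ^ (2 * k)) * indicator (ball 0 (sqrt (1 - p v))) t)" for t
      using slice_iff[OF v, of t p] cpair_project[OF v, of t]
      by (auto simp: fibre_monomial_def norm_mult norm_power power_mult_distrib power_mult[symmetric]
          mult.commute ennreal_mult split: split_indicator)
    have mb: "(\<lambda>t::complex. ennreal (norm t ^ (2 * k)) * indicator (ball 0 (sqrt (1 - p v))) t) \<in> borel_measurable lborel"
    proof -
      have [measurable]: "ball (0::complex) (sqrt (1 - p v)) \<in> sets borel" by simp
      show ?thesis by measurable
    qed
    show "(\<integral>\<^sup>+t. ?G (cpair t v) \<partial>lborel) = ennreal (pi / (real k + 1)) *
      (ennreal ((norm (f v))\<^sup>2 * (1 - p v) ^ (k + 1)) * indicator (ball_dom n p) v)"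
    proof (cases "v \<in> ball_dom n p")
      case True
      then have pv: "p v < 1" by (simp add: ball_dom_def)
      show ?thesis unfolding G nn_integral_cmult[OF mb]
        using True pv nn_integral_disc_power[of "sqrt (1 - p v)" k]
        by (simp add: ennreal_mult[symmetric] mult_ac)
    qed (unfold G, simp)
  qed
  also have "\<dots> = ennreal (pi / (real k + 1)) *
      (\<integral>\<^sup>+v\<in>ball_dom n p. ennreal ((norm (f v))\<^sup>2 * (1 - p v) ^ (k + 1)) \<partial>leb {1..n})"
  proof (rule nn_integral_cmult)
    have "continuous_on (ball_dom n p) (\<lambda>v. (norm (f v))\<^sup>2 * (1 - p v) ^ (k + 1))"
      by (intro continuous_on_mult continuous_on_weight[OF p] continuous_intros F(2))
    then show "(\<lambda>v. ennreal ((norm (f v))\<^sup>2 * (1 - p v) ^ (k + 1)) * indicator (ball_dom n p) v)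
        \<in> borel_measurable (leb {1..n})"
      by (rule borel_measurable_leb_continuous_ennreal[OF openin_ball_dom[OF p]])
  qed
  also have "\<dots> < \<infinity>" using F(3) by (simp add: ennreal_mult_less_top)
  finally show "(\<integral>\<^sup>+\<zeta>. ?G \<zeta> \<partial>leb {0..n}) < \<infinity>" .
qed auto

text \<open>
  Fubini and the coefficient formula on the discs. The formula needs the restriction of \<open>b\<close> to the
  fibre to be integrable, which holds for almost every fibre.
\<close>

lemma inner_fibre_monomial:
  assumes p: "continuous_on (cspace {1..n}) p"
    and f: "f \<in> A2 {1..n} (ball_dom n p) (\<lambda>u. (1 - p u) ^ (k + 1))"
    and b: "b \<in> A2 {0..n} (ellipsoid_dom n p) (\<lambda>_. 1)"
  shows "(LINT \<zeta>:ellipsoid_dom n p|leb {0..n}. fibre_monomial f k \<zeta> * cnj (b \<zeta>))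
    = of_real (pi / (real k + 1)) * (LINT v:ball_dom n p|leb {1..n}.
        f v * cnj (fibre_coeff b k v) * of_real ((1 - p v) ^ (k + 1)))"
proof -
  have bh: "holomorphic_several {0..n} b (ellipsoid_dom n p)" using b by (simp add: A2_def)
  note S = A2_ellipsoid_slices[OF p b]
  let ?N = "\<lambda>v. \<integral>\<^sup>+t. ennreal ((norm (b (cpair t v)))\<^sup>2) * indicator (ellipsoid_dom n p) (cpair t v) \<partial>lborel"
  let ?H = "\<lambda>\<zeta>. indicator (ellipsoid_dom n p) \<zeta> *\<^sub>R (fibre_monomial f k \<zeta> * cnj (b \<zeta>))"
  have "integrable (leb {0..n}) ?H"
    using A2_integrable_inner[OF openin_ellipsoid_dom[OF p] _ _ fibre_monomial_A2[OF p f] b]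
    by (simp add: set_integrable_def)
  then have "(LINT \<zeta>|leb {0..n}. ?H \<zeta>) = (LINT v|leb {1..n}. (LINT t|lborel. ?H (cpair t v)))"
    by (rule integral_leb_cpair)
  also have "\<dots> = (LINT v|leb {1..n}. of_real (pi / (real k + 1)) * (indicator (ball_dom n p) v *\<^sub>R
      (f v * cnj (fibre_coeff b k v) * of_real ((1 - p v) ^ (k + 1)))))"
  proof (rule integral_cong_AE)
    have "continuous_on (ball_dom n p) (\<lambda>v. f v * cnj (fibre_coeff b k v) * complex_of_real ((1 - p v) ^ (k + 1)))"
      by (intro continuous_on_mult continuous_on_of_real continuous_on_weight[OF p] continuous_on_cnj
          A2_D(2)[OF f weight_nonneg] A2_D(2)[OF fibre_coeff_A2[OF p b] weight_nonneg])
    from borel_measurable_leb_continuous[OF openin_ball_dom[OF p] this]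
    show "(\<lambda>v. of_real (pi / (real k + 1)) * (indicator (ball_dom n p) v *\<^sub>R
      (f v * cnj (fibre_coeff b k v) * complex_of_real ((1 - p v) ^ (k + 1))))) \<in> borel_measurable (leb {1..n})"
      by (intro borel_measurable_times borel_measurable_const)
    show "(\<lambda>v. LINT t|lborel. ?H (cpair t v)) \<in> borel_measurable (leb {1..n})"
    proof -
      have "(\<lambda>(v, t). cpair t v) \<in> (leb {1..n} \<Otimes>\<^sub>M lborel) \<rightarrow>\<^sub>M leb {0..n}"
        unfolding leb_def insert_zero_interval cpair_def by measurable
      from measurable_compose[OF this borel_measurable_integrable[OF \<open>integrable (leb {0..n}) ?H\<close>]]
      show ?thesis
        by (intro lborel.borel_measurable_lebesgue_integral) (simp add: case_prod_unfold)
    qed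
    have "AE v in leb {1..n}. ?N v < \<infinity>"
      using nn_integral_PInf_AE[OF S(1)] S(2) by (auto simp: less_top)
    then show "AE v in leb {1..n}. (LINT t|lborel. ?H (cpair t v)) =
      of_real (pi / (real k + 1)) * (indicator (ball_dom n p) v *\<^sub>R
      (f v * cnj (fibre_coeff b k v) * of_real ((1 - p v) ^ (k + 1))))"
      using AE_space
    proof eventually_elim
      case (elim v)
      then have v: "v \<in> cspace {1..n}" by (simp add: space_leb)
      show ?case
      proof (cases "v \<in> ball_dom n p")
        case False
        then show ?thesis using slice_iff[OF v, of _ p] by simp
      next
        case True
        then have pv: "p v < 1" by (simp add: ball_dom_def)
        let ?h = "\<lambda>t. b (cpair t v)" and ?R = "sqrt (1 - p v)"
        have hol: "?h holomorphic_on ball 0 ?R" by (rule slice_holomorphic[OF bh True])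
        have hi: "set_integrable lborel (ball 0 ?R) ?h"
          using elim(1) unfolding S(3)[OF True] by (rule set_integrable_disc_if_square(2)[OF hol])
        have "(LINT t|lborel. ?H (cpair t v))
            = (LINT t|lborel. f v * cnj (indicator (ball 0 ?R) t *\<^sub>R (?h t * cnj t ^ k)))"
          using slice_iff[OF v, of _ p] cpair_project[OF v] True
          by (intro Bochner_Integration.integral_cong)
            (auto simp: fibre_monomial_def split: split_indicator)
        also have "\<dots> = f v * cnj (LINT t:ball 0 ?R|lborel. ?h t * cnj t ^ k)"
          by (simp only: set_lebesgue_integral_def integral_mult_right_zero Bochner_Integration.integral_cnj)
        also have "\<dots> = f v * cnj (fibre_coeff b k v * of_real (pi * (1 - p v) ^ (k + 1) / (real k + 1)))"
          using disc_integral_eq_taylor_coeff[OF hol _ hi, of k] pv by (simp add: fibre_coeff_def)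
        finally show ?thesis using True by simp
      qed
    qed
  qed
  also have "\<dots> = of_real (pi / (real k + 1)) * (LINT v:ball_dom n p|leb {1..n}.
        f v * cnj (fibre_coeff b k v) * of_real ((1 - p v) ^ (k + 1)))"
    by (simp only: set_lebesgue_integral_def integral_mult_right_zero)
  finally show ?thesis by (simp only: set_lebesgue_integral_def)
qed

section \<open>The Bergman kernel of the ellipsoid\<close>

theorem theorem6:
  fixes n :: nat and m :: "nat \<Rightarrow> nat" and p :: "point \<Rightarrow> real"
    and Y :: "nat \<Rightarrow> point \<Rightarrow> point \<Rightarrow> complex" and B :: "point \<Rightarrow> point \<Rightarrow> complex"
    and z Z :: complex and w W :: point
  assumes "\<forall>i\<in>{1..n}. 0 < m i"
    and "weighted_homogeneous_balanced n m p"
    and "\<forall>u\<in>cspace {1..n}. 0 \<le> p u"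
    and "\<forall>k. is_reproducing_kernel {1..n} (ball_dom n p) (\<lambda>u. (1 - p u) ^ (k + 1)) (Y k)"
    and "is_Bergman_kernel {0..n} (ellipsoid_dom n p) B"
    and "w \<in> cspace {1..n}" and "W \<in> cspace {1..n}"
    and "cpair z w \<in> ellipsoid_dom n p" and "cpair Z W \<in> ellipsoid_dom n p"
  shows "(\<lambda>k. complex_of_real ((real k + 1) / pi) * Y k w W * z ^ k * cnj Z ^ k)
           sums B (cpair z w) (cpair Z W)"
proof -
  have p: "continuous_on (cspace {1..n}) p"
    using assms(2) by (rule weighted_homogeneous_continuous)
  have w: "w \<in> ball_dom n p" and W: "W \<in> ball_dom n p" "Z \<in> ball 0 (sqrt (1 - p W))"
    using assms(8,9) slice_iff[OF assms(6)] slice_iff[OF assms(7)] by auto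
  \<comment> \<open>The element of the Bergman space that represents evaluation at the first point.\<close>
  define b where "b = (\<lambda>\<zeta>. cnj (B (cpair z w) \<zeta>))"
  have b: "b \<in> A2 {0..n} (ellipsoid_dom n p) (\<lambda>_. 1)"
    using assms(5,8) unfolding is_Bergman_kernel_def is_reproducing_kernel_def b_def by blast
  have repr: "F (cpair z w) = (LINT \<zeta>:ellipsoid_dom n p|leb {0..n}. F \<zeta> * cnj (b \<zeta>))"
      if "F \<in> A2 {0..n} (ellipsoid_dom n p) (\<lambda>_. 1)" for F
    using assms(5,8) that unfolding is_Bergman_kernel_def is_reproducing_kernel_def b_def by simp
  have coeff: "fibre_coeff b k W = cnj (complex_of_real ((real k + 1) / pi) * Y k w W * z ^ k)" for k
  proof -
    define \<rho> where "\<rho> = (\<lambda>u. (1 - p u) ^ (k + 1))"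
    define c where "c = complex_of_real ((real k + 1) / pi) * z ^ k"
    \<comment> \<open>Both this function and the coefficient of b represent the same multiple of evaluation at w.\<close>
    define g where "g = (\<lambda>v. cnj c * cnj (Y k w v))"
    have Yk: "(\<lambda>v. cnj (Y k w v)) \<in> A2 {1..n} (ball_dom n p) \<rho>"
      using assms(4) w unfolding is_reproducing_kernel_def \<rho>_def by blast
    have Yrepr: "f w = (LINT v:ball_dom n p|leb {1..n}. f v * Y k w v * of_real (\<rho> v))"
        if "f \<in> A2 {1..n} (ball_dom n p) \<rho>" for f
      using assms(4) w that unfolding is_reproducing_kernel_def \<rho>_def by blast
    have \<rho>: "continuous_on (ball_dom n p) \<rho>" "\<forall>v\<in>ball_dom n p. 0 < \<rho> v"
      using continuous_on_weight[OF p, of k] weight_pos[of n p k] by (simp_all add: \<rho>_def)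
    have g: "g \<in> A2 {1..n} (ball_dom n p) \<rho>"
      using A2_linear_combination[OF openin_ball_dom[OF p] \<rho>(1) _ Yk Yk, where a = "cnj c" and b = 0] \<rho>(2)
      by (auto simp: g_def intro: less_imp_le)
    have "fibre_coeff b k W = g W"
    proof (rule A2_representer_unique[OF _ openin_ball_dom[OF p] \<rho> _ g _ W(1)])
      show "fibre_coeff b k \<in> A2 {1..n} (ball_dom n p) \<rho>"
        unfolding \<rho>_def by (rule fibre_coeff_A2[OF p b])
      fix f assume f: "f \<in> A2 {1..n} (ball_dom n p) \<rho>"
      let ?I = "LINT v:ball_dom n p|leb {1..n}. f v * cnj (fibre_coeff b k v) * of_real (\<rho> v)"
      have "f w * z ^ k = fibre_monomial f k (cpair z w)"
        using cpair_project[OF assms(6), of z] by (simp add: fibre_monomial_def)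
      also have "\<dots> = of_real (pi / (real k + 1)) * ?I"
        using repr[OF fibre_monomial_A2[OF p]] inner_fibre_monomial[OF p _ b] f by (simp add: \<rho>_def)
      finally have "of_real ((real k + 1) / pi) * (f w * z ^ k)
          = of_real ((real k + 1) / pi * (pi / (real k + 1))) * ?I"
        by (simp only: of_real_mult mult.assoc)
      then have "?I = c * f w"
        by (simp add: c_def mult_ac)
      also have "\<dots> = (LINT v:ball_dom n p|leb {1..n}. c * (f v * Y k w v * of_real (\<rho> v)))"
        by (subst Yrepr[OF f]) simp
      also have "\<dots> = (LINT v:ball_dom n p|leb {1..n}. f v * cnj (g v) * of_real (\<rho> v))"
        by (simp add: g_def mult_ac)
      finally show "?I = (LINT v:ball_dom n p|leb {1..n}. f v * cnj (g v) * of_real (\<rho> v))" .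
    qed simp
    then show ?thesis by (simp add: g_def c_def mult_ac)
  qed
  have "(\<lambda>t. b (cpair t W)) holomorphic_on ball 0 (sqrt (1 - p W))"
    using b W(1) by (auto simp: A2_def intro: slice_holomorphic)
  from holomorphic_power_series[OF this W(2)]
  have "(\<lambda>k. fibre_coeff b k W * Z ^ k) sums b (cpair Z W)"
    by (simp add: fibre_coeff_def taylor_coeff_def)
  then have "(\<lambda>k. cnj (fibre_coeff b k W * Z ^ k)) sums cnj (b (cpair Z W))"
    by (simp only: sums_cnj)
  then show ?thesis unfolding coeff by (simp add: b_def)
qed

end
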